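(* The map $\Phi$ from the set $\mathcal{I}$ of all Tamari intervals to the set $\mathcal{EF}$ of all extended fighting fish, defined recursively by $\Phi([\bullet,\bullet])=\varepsilon$ and $\Phi(\oplus_{\mathcal I}(I_1^{\bullet i},I_2))=\oplus_{\mathcal F}(\Phi(I_1)^{\bullet i},\Phi(I_2))$ for every pointed Tamari interval $I_1^{\bullet i}$ and every Tamari interval $I_2$, is (well defined and) a bijection such that for every Tamari interval $I$ of size $n\ge 0$, the extended fighting fish $\Phi(I)$ has size $n$, and $$\mathrm{jaw}(\Phi(I))=c_0(I),\qquad \mathrm{area}(\Phi(I))=\mathrm{d}(I)+n .$$ Moreover, the restriction of $\Phi$ to synchronized intervals induces a bijection from the set $\mathcal{SI}$ of synchronized Tamari intervals to the set $\mathcal{F}$ of fighting fish.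
   Context: **Fish.** Non-empty fighting fish are the words on $\{E,N,W,S\}$ obtainable from $ENWS$ by finitely many operations of the form: replace a factor (contiguous subword) $W$ by $NWS$; replace a factor $N$ by $ENW$; replace a factor $WN$ by $NW$. Non-empty extended fighting fish are the words on $\{E,N,W,S,V\}$ obtained from a non-empty fighting fish by choosing a (possibly empty) set of occurrences of the factor $WN$ and replacing each chosen one by the letter $V$. In addition there is the empty fish $\varepsilon$, the word $EVS$, which is considered to be both a fighting fish and an extended fighting fish. $\mathcal{EF}$ (resp. $\mathcal{F}$) is the set of all extended fighting fish (resp. fighting fish), including $\varepsilon$. With $|F|_X$ the number of letters $X$ in $F$: $\mathrm{size}(F)=|F|_E+|F|_N-1$. The area (number of cells) is $\mathrm{area}(F)=\sum_{k=1}^m(\mathrm{lat}(F^{\le k})-\mathrm{lat}(F^{\le k-1}))\,\mathrm{long}(F^{\le k})$, where $m$ is the length of the word $F$, $F^{\le k}$ its prefix of length $k$, $\mathrm{lat}(w)=|w|_N-|w|_S+|w|_V$, $\mathrm{long}(w)=|w|_E-|w|_W-|w|_V$. The jaw length $\mathrm{jaw}(F)$ of a non-empty $F$ is the number of initial consecutive letters $E$ (the next letter is then always $N$); $\mathrm{jaw}(\varepsilon)=0$. Concatenation: for non-empty $F_1=G_1S$ and $F_2=E^{\mathrm{jaw}(F_2)}NG_2$, $F_1\odot F_2=E^{\mathrm{jaw}(F_2)}G_1G_2$; and $F\odot\varepsilon=\varepsilon\odot F=F$. Augmentation: for non-empty $F=E^{j}NG$ with $j=\mathrm{jaw}(F)$,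 $\maltese_i(F)=E^iNE^{j-i}NGS$ if $1\le i\le j$, and $\maltese_{j+1}(F)=E^{j+1}NVGS$; and $\maltese_1(\varepsilon)=ENWS$. A pointed extended fighting fish $F^{\bullet i}$ is a pair $(F,i)$ with $1\le i\le \mathrm{jaw}(F)+1$. Set $\oplus_{\mathcal F}(F_1^{\bullet i},F_2)=\maltese_i(F_1)\odot F_2$. **Dyck paths.** A Dyck path of size $n$ is a word with $n$ letters $u=(1,1)$ and $n$ letters $d=(1,-1)$, seen as a walk from $(0,0)$ staying weakly above the $x$-axis; $\bullet$ is the empty path. A contact is a point of the path on the $x$-axis. The Tamari order $\preceq$ on Dyck paths of size $n$ is the reflexive transitive closure of: $VdP_1W$ is covered by $VP_1dW$, where $V,W$ are words and $P_1$ is a non-empty Dyck path returning to the $x$-axis only at its end. The contact vector of $P$ is $(c_0(P),\dots,c_n(P))$ where $c_0(P)$ is the number of non-initial contacts of $P$ and $c_k(P)$, $k\ge1$, is the number of non-initial contacts of the (maximal) Dyck path following the $k$-th up step of $P$. The type of $P$ is $(\mathbf 1_{c_0(P)>0},\dots,\mathbf 1_{c_n(P)>0})$. **Intervals.** A Tamari interval of size $n$ is a pair $I=[P,Q]$ of Dyck paths of size $n$ with $P\preceq Q$; $c_0(I)=c_0(P)$. It is synchronized if $P$ and $Q$ have the same type. The Tamari distance $\mathrm{d}(I)$ is the largest $k$ such that there is a strictly increasing chain $P=D_0\prec D_1\prec\dots\prec D_k=Q$. A pointed Tamari interval $I^{\bullet i}$ is an interval $I=[P,Q]$ with an integer $1\le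 i\le c_0(I)+1$; it singles out the $i$-th contact of $P$ counted from right to left, which splits $P=P^\ell P^r$ into two (possibly empty) Dyck paths. Set $[P_1,Q_1]\odot[P_2,Q_2]=[P_1P_2,Q_1Q_2]$, $\maltese_i([P_1,Q_1])=[uP_1^\ell dP_1^r,uQ_1d]$, and $\oplus_{\mathcal I}(I_1^{\bullet i},I_2)=\maltese_i(I_1)\odot I_2$. It is known (Bousquet-Mélou, Fusy, Préville-Ratelle) that $\oplus_{\mathcal I}$ is a bijection from pairs (pointed Tamari interval, Tamari interval) to Tamari intervals different from $[\bullet,\bullet]$. *)

theory Defs
  imports Main
begin

section \<open>Fighting fish\<close>

datatype letter = E | N | W | S | V

inductive_set nonempty_fish :: "letter list set" where
  base: "[E, N, W, S] \<in> nonempty_fish"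
| W_NWS: "x @ [W] @ y \<in> nonempty_fish \<Longrightarrow> x @ [N, W, S] @ y \<in> nonempty_fish"
| N_ENW: "x @ [N] @ y \<in> nonempty_fish \<Longrightarrow> x @ [E, N, W] @ y \<in> nonempty_fish"
| WN_NW: "x @ [W, N] @ y \<in> nonempty_fish \<Longrightarrow> x @ [N, W] @ y \<in> nonempty_fish"

text \<open>
  \<open>contract_WN w w'\<close>: the word \<open>w'\<close> is obtained from \<open>w\<close> by choosing a set of occurrences of the
  factor \<open>WN\<close> (two such occurrences never overlap) and replacing each chosen one by \<open>V\<close>.
\<close>

inductive contract_WN :: "letter list \<Rightarrow> letter list \<Rightarrow> bool" where
  nil: "contract_WN [] []"
| keep: "contract_WN w w' \<Longrightarrow> contract_WN (x # w) (x # w')"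
| replace: "contract_WN w w' \<Longrightarrow> contract_WN (W # N # w) (V # w')"

definition nonempty_extended_fish :: "letter list set" where
  "nonempty_extended_fish = {w'. \<exists>w \<in> nonempty_fish. contract_WN w w'}"

definition empty_fish :: "letter list" where
  "empty_fish = [E, V, S]"

definition fighting_fish :: "letter list set" where
  "fighting_fish = nonempty_fish \<union> {empty_fish}"

definition extended_fish :: "letter list set" where
  "extended_fish = nonempty_extended_fish \<union> {empty_fish}"

definition fish_size :: "letter list \<Rightarrow> int" where
  "fish_size F = int (count_list F E) + int (count_list F N) - 1"

definition lat :: "letter list \<Rightarrow> int" where
  "lat w = int (count_list w N) - int (count_list w S) + int (count_list w V)"

definition long :: "letter list \<Rightarrow> int" where
  "long w = int (count_list w E) - int (count_list w W) - int (count_list w V)"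

definition area :: "letter list \<Rightarrow> int" where
  "area F = (\<Sum>k = 1..length F. (lat (take k F) - lat (take (k - 1) F)) * long (take k F))"

definition jaw :: "letter list \<Rightarrow> nat" where
  "jaw F = (if F = empty_fish then 0 else length (takeWhile (\<lambda>x. x = E) F))"

definition fish_concat :: "letter list \<Rightarrow> letter list \<Rightarrow> letter list" where
  "fish_concat F1 F2 =
     (if F1 = empty_fish then F2
      else if F2 = empty_fish then F1
      else replicate (jaw F2) E @ butlast F1 @ drop (jaw F2 + 1) F2)"

text \<open>
  The value of \<open>fish_augment i F\<close> is meaningful only for a pointed fish, i.e. for
  \<open>1 \<le> i \<le> jaw F + 1\<close>; the two cases of the inner conditional are then \<open>i \<le> jaw F\<close> and \<open>i = jaw F + 1\<close>.
\<close>

definition fish_augment :: "nat \<Rightarrow> letter list \<Rightarrow> letter list" where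
  "fish_augment i F =
     (if F = empty_fish then [E, N, W, S]
      else let j = jaw F; G = drop (j + 1) F in
        if i \<le> j then replicate i E @ [N] @ replicate (j - i) E @ [N] @ G @ [S]
        else replicate (j + 1) E @ [N, V] @ G @ [S])"

definition pointed_fish :: "letter list \<Rightarrow> nat \<Rightarrow> bool" where
  "pointed_fish F i \<longleftrightarrow> F \<in> extended_fish \<and> 1 \<le> i \<and> i \<le> jaw F + 1"

definition fish_oplus :: "letter list \<Rightarrow> nat \<Rightarrow> letter list \<Rightarrow> letter list" where
  "fish_oplus F1 i F2 = fish_concat (fish_augment i F1) F2"


section \<open>Dyck paths and the Tamari order\<close>

datatype step = U | D

definition height :: "step list \<Rightarrow> int" where
  "height w = int (count_list w U) - int (count_list w D)"

definition is_dyck :: "step list \<Rightarrow> bool" where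
  "is_dyck P \<longleftrightarrow> height P = 0 \<and> (\<forall>k \<le> length P. 0 \<le> height (take k P))"

definition path_size :: "step list \<Rightarrow> nat" where
  "path_size P = count_list P U"

text \<open>Abscissas of the contacts, from left to right; the initial point is included.\<close>

definition contacts :: "step list \<Rightarrow> nat list" where
  "contacts P = filter (\<lambda>k. height (take k P) = 0) [0..<length P + 1]"

definition noninitial_contacts :: "step list \<Rightarrow> nat" where
  "noninitial_contacts P = length (filter (\<lambda>k. 0 < k) (contacts P))"

inductive tamari_cover :: "step list \<Rightarrow> step list \<Rightarrow> bool" where
  "is_dyck (v @ [D] @ P1 @ w) \<Longrightarrow> is_dyck P1 \<Longrightarrow> P1 \<noteq> [] \<Longrightarrow> noninitial_contacts P1 = 1 \<Longrightarrow>
   tamari_cover (v @ [D] @ P1 @ w) (v @ P1 @ [D] @ w)"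

definition tamari_le :: "step list \<Rightarrow> step list \<Rightarrow> bool" where
  "tamari_le = tamari_cover\<^sup>*\<^sup>*"

text \<open>\<open>after_up k P\<close> is what remains of \<open>P\<close> after its \<open>k\<close>-th up step.\<close>

fun after_up :: "nat \<Rightarrow> step list \<Rightarrow> step list" where
  "after_up 0 P = P"
| "after_up (Suc k) [] = []"
| "after_up (Suc k) (U # P) = after_up k P"
| "after_up (Suc k) (D # P) = after_up (Suc k) P"

definition max_dyck_prefix :: "step list \<Rightarrow> step list" where
  "max_dyck_prefix w = take (Max {l. l \<le> length w \<and> is_dyck (take l w)}) w"

definition contact_entry :: "step list \<Rightarrow> nat \<Rightarrow> nat" where
  "contact_entry P k =
     (if k = 0 then noninitial_contacts P
      else noninitial_contacts (max_dyck_prefix (after_up k P)))"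

definition contact_vector :: "step list \<Rightarrow> nat list" where
  "contact_vector P = map (contact_entry P) [0..<path_size P + 1]"

definition path_type :: "step list \<Rightarrow> nat list" where
  "path_type P = map (\<lambda>c. of_bool (c > 0)) (contact_vector P)"


section \<open>Tamari intervals\<close>

type_synonym interval = "step list \<times> step list"

definition tamari_intervals_of_size :: "nat \<Rightarrow> interval set" where
  "tamari_intervals_of_size n =
     {(P, Q). is_dyck P \<and> is_dyck Q \<and> path_size P = n \<and> path_size Q = n \<and> tamari_le P Q}"

definition tamari_intervals :: "interval set" where
  "tamari_intervals = (\<Union>n. tamari_intervals_of_size n)"

definition synchronized_intervals :: "interval set" where
  "synchronized_intervals = {(P, Q) \<in> tamari_intervals. path_type P = path_type Q}"

definition empty_interval :: interval where
  "empty_interval = ([], [])"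

definition interval_contacts :: "interval \<Rightarrow> nat" where
  "interval_contacts I = noninitial_contacts (fst I)"

definition tamari_distance :: "interval \<Rightarrow> nat" where
  "tamari_distance I =
     Max {k. \<exists>C :: nat \<Rightarrow> step list. C 0 = fst I \<and> C k = snd I \<and>
             (\<forall>i<k. tamari_le (C i) (C (Suc i)) \<and> C i \<noteq> C (Suc i))}"

definition pointed_interval :: "interval \<Rightarrow> nat \<Rightarrow> bool" where
  "pointed_interval I i \<longleftrightarrow> I \<in> tamari_intervals \<and> 1 \<le> i \<and> i \<le> interval_contacts I + 1"

definition left_part :: "nat \<Rightarrow> step list \<Rightarrow> step list" where
  "left_part i P = take (rev (contacts P) ! (i - 1)) P"

definition right_part :: "nat \<Rightarrow> step list \<Rightarrow> step list" where
  "right_part i P = drop (rev (contacts P) ! (i - 1)) P"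

definition interval_concat :: "interval \<Rightarrow> interval \<Rightarrow> interval" where
  "interval_concat I1 I2 = (fst I1 @ fst I2, snd I1 @ snd I2)"

definition interval_augment :: "nat \<Rightarrow> interval \<Rightarrow> interval" where
  "interval_augment i I =
     ([U] @ left_part i (fst I) @ [D] @ right_part i (fst I), [U] @ snd I @ [D])"

definition interval_oplus :: "interval \<Rightarrow> nat \<Rightarrow> interval \<Rightarrow> interval" where
  "interval_oplus I1 i I2 = interval_concat (interval_augment i I1) I2"

text \<open>
  The recursive equations for a map from intervals to fish. They only constrain its values on
  \<^const>\<open>tamari_intervals\<close>.
\<close>

definition fish_recursion :: "(interval \<Rightarrow> letter list) \<Rightarrow> bool" where
  "fish_recursion \<Phi> \<longleftrightarrow>
     \<Phi> empty_interval = empty_fish \<and>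
     (\<forall>I1 i I2. pointed_interval I1 i \<longrightarrow> I2 \<in> tamari_intervals \<longrightarrow>
        \<Phi> (interval_oplus I1 i I2) = fish_oplus (\<Phi> I1) i (\<Phi> I2))"

end

theory Submission
  imports Defs
begin

text \<open>
  Intervals and fish are both freely generated: every interval is obtained from the empty one in exactly
  one way by repeated use of \<open>interval_oplus\<close>, and every extended fish in exactly one way
  from the empty fish by repeated use of \<open>fish_oplus\<close>. The two histories are recorded by
  the same objects, binary trees \<open>Node t i s\<close> whose nodes carry the index \<open>i\<close>
  of a pointing (\<open>valid\<close> trees), because the jaw length and the number of non-initial
  contacts obey the same recursion \<open>valence\<close>. So \<open>\<Phi>\<close> is
  \<open>fish_of\<close> after the inverse of \<open>interval_of\<close>, and each statistic only has to
  be read off the tree on either side.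

  On the fish side, a non-empty extended fish is \<open>E\<^sup>j N G S\<close>, where \<open>j\<close>
  is the \<open>valence\<close> and \<open>G\<close> the \<open>tail\<close> of a tree. The tail
  determines the tree (\<open>tail_inj\<close>): inside a tail the latitude never gets below its initial
  value, so the \<open>S\<close> that ends the first component is the first letter to fall below that
  value. The rewriting rules of fish, applied to the tail of a tree that produces no letter
  \<open>V\<close>, lead to the tail of another such tree (\<open>grow_tail\<close>); conversely the
  pieces glued by \<open>fish_oplus\<close> are derivable from \<open>N\<close>
  (\<open>grows_tail\<close>), because augmentation can follow a derivation step by step
  (\<open>grows_augment\<close>). Contracting factors \<open>WN\<close> then accounts for the remaining
  valid trees (\<open>contract_tail\<close>, \<open>tail_contraction\<close>).

  On the interval side everything rests on pulling a chain of covers back through a decomposition of its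
  top element. A chain that ends in \<open>Q\<^sub>1 Q\<^sub>2\<close> is a shuffle of two chains
  (\<open>relpowp_cover_into_append\<close>). A chain that ends in \<open>u Q d\<close> starts at some
  \<open>u A d B\<close>; each of its covers either is a cover in \<open>A B\<close> or moves the
  distinguished \<open>d\<close> across one prime factor of \<open>B\<close>
  (\<open>relpowp_cover_into_prime\<close>). This gives the decomposition of every interval, and also
  the longest chains: crossing \<open>B\<close> costs at most its number of contacts, which for the
  pointing \<open>i\<close> is \<open>i - 1\<close>, and this bound is attained by crossing first. Hence
  the distance is the sum of all \<open>i - 1\<close>, while the area grows by \<open>i\<close> and the
  size by one at each node.

  Finally, the type of a Dyck path only records, besides its first entry, which up steps are followed by
  an up step. Comparing \<open>u A d B P\<close> with \<open>u Q\<^sub>1 d Q\<^sub>2\<close> shows that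
  an interval is synchronized if and only if no node points at the initial contact of a non-empty path.
  These are precisely the nodes at which \<open>fish_oplus\<close> writes a letter \<open>V\<close>.
\<close>

section \<open>Decomposition trees\<close>

text \<open>
  \<open>Node t i s\<close> stands for the object built from the one of \<open>t\<close>, pointed at
  \<open>i\<close>, and the one of \<open>s\<close>.
\<close>

datatype dtree = Leaf | Node dtree nat dtree

text \<open>
  The common value of the jaw length and of the number of non-initial contacts.
\<close>

fun valence :: "dtree \<Rightarrow> nat" where
  "valence Leaf = 0"
| "valence (Node t i s) = i + valence s"

fun valid :: "dtree \<Rightarrow> bool" where
  "valid Leaf \<longleftrightarrow> True"
| "valid (Node t i s) \<longleftrightarrow> valid t \<and> valid s \<and> 1 \<le> i \<and> i \<le> valence t + 1"

text \<open>
  The trees that never use the last admissible pointing of a non-empty object. They correspond to fish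
  without \<open>V\<close> and to synchronized intervals.
\<close>

fun smooth :: "dtree \<Rightarrow> bool" where
  "smooth Leaf \<longleftrightarrow> True"
| "smooth (Node t i s) \<longleftrightarrow> smooth t \<and> smooth s \<and> (t = Leaf \<or> i \<le> valence t)"

fun nodes :: "dtree \<Rightarrow> nat" where
  "nodes Leaf = 0"
| "nodes (Node t i s) = nodes t + nodes s + 1"

text \<open>
  The Tamari distance of the corresponding interval, see \<open>longest_chain_oplus\<close> below.
\<close>

fun slack :: "dtree \<Rightarrow> nat" where
  "slack Leaf = 0"
| "slack (Node t i s) = slack t + (i - 1) + slack s"

section \<open>The fish of a tree\<close>

fun fish_of :: "dtree \<Rightarrow> letter list" where
  "fish_of Leaf = empty_fish"
| "fish_of (Node t i s) = fish_oplus (fish_of t) i (fish_of s)"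

text \<open>
  The fish of a tree is \<open>E\<^sup>j N G S\<close>, where \<open>j\<close> is the valence and
  \<open>G\<close> the tail. Leaving out the jaw, the first \<open>N\<close> and the last
  \<open>S\<close> turns concatenation of fish into concatenation of words.
\<close>

fun tail :: "dtree \<Rightarrow> letter list" where
  "tail Leaf = []"
| "tail (Node t i s) =
     (if t = Leaf then [W]
      else if i \<le> valence t then replicate (valence t - i) E @ [N] @ tail t @ [S]
      else [V] @ tail t @ [S]) @ tail s"

lemma valence_pos_iff: "valid t \<Longrightarrow> 0 < valence t \<longleftrightarrow> t \<noteq> Leaf"
  by (cases t) auto

definition jawed :: "nat \<Rightarrow> letter list \<Rightarrow> letter list" where
  "jawed j G = replicate j E @ N # G @ [S]"

lemma jawed_neq_empty_fish: "jawed j G \<noteq> empty_fish"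
  by (cases j; cases "j - 1") (auto simp: jawed_def empty_fish_def)

lemma takeWhile_replicate_E: "takeWhile (\<lambda>x. x = E) (replicate j E @ N # G) = replicate j E"
  by (induction j) auto

lemma jaw_jawed: "jaw (jawed j G) = j"
  using jawed_neq_empty_fish[of j G] by (simp add: jaw_def jawed_def takeWhile_replicate_E)

lemma drop_jawed: "drop (Suc j) (jawed j G) = G @ [S]"
  by (simp add: jawed_def)

lemma butlast_jawed: "butlast (jawed j G) = replicate j E @ N # G"
  by (simp add: jawed_def butlast_append)

lemma fish_concat_jawed:
  "fish_concat (jawed i G) (jawed j H) = jawed (j + i) (G @ H)"
  by (simp add: fish_concat_def jawed_neq_empty_fish jaw_jawed drop_jawed butlast_jawed)
     (simp add: jawed_def replicate_add)

lemma fish_augment_empty: "fish_augment i empty_fish = jawed 1 [W]"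
  by (simp add: fish_augment_def jawed_def)

lemma fish_augment_jawed:
  assumes "i \<le> j + 1"
  shows "fish_augment i (jawed j G) =
    jawed i (if i \<le> j then replicate (j - i) E @ [N] @ G @ [S] else [V] @ G @ [S])"
proof (cases "i \<le> j")
  case True
  then show ?thesis
    by (simp add: fish_augment_def jawed_neq_empty_fish jaw_jawed drop_jawed Let_def)
       (simp add: jawed_def)
next
  case False
  then have "i = j + 1" using assms by simp
  then show ?thesis
    by (simp add: fish_augment_def jawed_neq_empty_fish jaw_jawed drop_jawed Let_def)
       (simp add: jawed_def)
qed

text \<open>
  The empty fish has to be kept apart, since it does not have the form \<open>E\<^sup>j N G S\<close>;
  this is also why \<open>tail\<close> has a separate clause for an augmented leaf.
\<close>

lemma fish_of_eq:
  "valid t \<Longrightarrow> fish_of t = (if t = Leaf then empty_fish else jawed (valence t) (tail t))"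
proof (induction t)
  case (Node t i s)
  then have i: "1 \<le> i" "i \<le> valence t + 1" by auto
  have aug: "fish_augment i (fish_of t) = jawed i (if t = Leaf then [W]
      else if i \<le> valence t then replicate (valence t - i) E @ [N] @ tail t @ [S]
      else [V] @ tail t @ [S])"
  proof (cases "t = Leaf")
    case True
    with i have "i = 1" by simp
    then show ?thesis using True by (simp add: fish_augment_empty)
  next
    case False
    then show ?thesis using Node fish_augment_jawed[OF i(2)] by simp
  qed
  show ?case
  proof (cases "s = Leaf")
    case True
    then show ?thesis
      unfolding fish_of.simps fish_oplus_def aug
      by (simp add: fish_concat_def jawed_neq_empty_fish)
  next
    case False
    then have "fish_of s = jawed (valence s) (tail s)" using Node by simp
    then show ?thesis
      unfolding fish_of.simps fish_oplus_def aug
      by (simp add: fish_concat_jawed add.commute)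
  qed
qed simp

lemma jaw_fish_of: "valid t \<Longrightarrow> jaw (fish_of t) = valence t"
  by (cases "t = Leaf") (simp_all add: fish_of_eq jaw_jawed jaw_def[of empty_fish])

section \<open>Size and area of a fish\<close>

lemma lat_simps [simp]:
  "lat [] = 0" "lat (E # w) = lat w" "lat (N # w) = 1 + lat w" "lat (W # w) = lat w"
  "lat (S # w) = lat w - 1" "lat (V # w) = 1 + lat w" "lat (v @ w) = lat v + lat w"
  "lat (replicate k E) = 0"
  by (auto simp: lat_def)

lemma long_simps [simp]:
  "long [] = 0" "long (E # w) = 1 + long w" "long (N # w) = long w" "long (W # w) = long w - 1"
  "long (S # w) = long w" "long (V # w) = long w - 1" "long (v @ w) = long v + long w"
  "long (replicate k E) = int k"
  by (auto simp: long_def) (induction k; simp)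

text \<open>
  The area of a word read from a point of given longitude. Unlike \<open>area\<close> it is additive in
  the word.
\<close>

fun area_from :: "int \<Rightarrow> letter list \<Rightarrow> int" where
  "area_from l [] = 0"
| "area_from l (x # w) = lat [x] * (l + long [x]) + area_from (l + long [x]) w"

lemma area_from_append [simp]: "area_from l (v @ w) = area_from l v + area_from (l + long v) w"
proof (induction v arbitrary: l)
  case (Cons x v)
  then show ?case by (cases x) (simp_all add: algebra_simps)
qed simp

lemma area_from_replicate [simp]: "area_from l (replicate k E) = 0"
  by (induction k arbitrary: l) auto

lemma area_eq_area_from: "area w = area_from 0 w"
proof (induction w rule: rev_induct)
  case (snoc x w)
  have "(\<Sum>k = 1..length w. (lat (take k (w @ [x])) - lat (take (k - 1) (w @ [x]))) * long (take k (w @ [x])))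
      = area w"
    unfolding area_def by (intro sum.cong) auto
  then have "area (w @ [x]) = area w + lat [x] * long (w @ [x])"
    by (simp add: area_def del: long_simps)
  then show ?case using snoc by simp
qed (simp add: area_def)

lemma lat_tail [simp]: "lat (tail t) = 0"
  by (induction t) auto

lemma long_tail: "valid t \<Longrightarrow> long (tail t) = - int (valence t)"
  by (induction t) (auto simp: of_nat_diff)

text \<open>
  The starting longitude is irrelevant because a tail has latitude \<open>0\<close> in total. The
  \<open>N\<close> or \<open>V\<close> before the tail of \<open>t\<close> and the \<open>S\<close>
  after it lie at longitudes that differ by the valence of \<open>t\<close>, so together they contribute
  this valence. Hence area plus valence is additive over the two subtrees, up to the pointing
  \<open>i\<close> in the valence of the node.
\<close>

lemma area_from_tail:
  "valid t \<Longrightarrow> area_from l (tail t) = int (slack t) + int (nodes t) - int (valence t)"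
proof (induction t arbitrary: l)
  case (Node t i s)
  then have "valid t" "1 \<le> i" "i \<le> valence t + 1" by auto
  then show ?case using Node by (auto simp: long_tail of_nat_diff)
qed simp

lemma area_fish_of: "valid t \<Longrightarrow> area (fish_of t) = int (slack t) + int (nodes t)"
  by (auto simp: fish_of_eq area_eq_area_from area_from_tail jawed_def empty_fish_def long_tail)

lemma count_replicate_E [simp]:
  "count_list (replicate k E) x = (if x = E then k else 0)"
  by (induction k) auto

lemma count_tail:
  "valid t \<Longrightarrow> valence t + count_list (tail t) E + count_list (tail t) N = nodes t"
  by (induction t) auto

lemma fish_size_fish_of: "valid t \<Longrightarrow> fish_size (fish_of t) = int (nodes t)"
  using count_tail[of t]
  by (auto simp: fish_of_eq fish_size_def jawed_def empty_fish_def)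

section \<open>The tree of a fish is unique\<close>

lemma lat_prefix_tail: "tail t = v @ w \<Longrightarrow> 0 \<le> lat v"
proof (induction t arbitrary: v w)
  case (Node t i s)
  define k where "k = valence t - i"
  have nonneg: "0 \<le> lat v" if "b @ tail s = v @ w" "lat b = 0" "\<And>x y. b = x @ y \<Longrightarrow> 0 \<le> lat x" for b
  proof -
    from that(1) consider r where "b = v @ r" | r where "v = b @ r" "tail s = r @ w"
      by (auto simp: append_eq_append_conv2)
    then show ?thesis using that Node.IH(2) by cases auto
  qed
  have mid: "0 \<le> lat x" if "a @ tail t @ [S] = x @ y" "\<And>x y. a = x @ y \<Longrightarrow> 0 \<le> lat x" "lat a = 1" for a x y
  proof -
    from that(1) consider r where "a = x @ r" | r q where "x = a @ r" "tail t = r @ q"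
      | "x = a @ tail t @ [S]"
      by (auto simp: append_eq_append_conv2 Cons_eq_append_conv)
    then show ?thesis using that Node.IH(1) by cases auto
  qed
  have E_run: "0 \<le> lat x" if "replicate k E @ [N] = x @ y" for x y
    using that by (induction k arbitrary: x) (auto simp: Cons_eq_append_conv)
  consider "t = Leaf" | "t \<noteq> Leaf" "i \<le> valence t" | "t \<noteq> Leaf" "\<not> i \<le> valence t" by blast
  then show ?case
  proof cases
    case 1
    have "0 \<le> lat x" if "[W] = x @ y" for x y
      using that by (auto simp: Cons_eq_append_conv)
    then show ?thesis using nonneg[of "[W]"] Node.prems 1 by simp
  next
    case 2
    have "0 \<le> lat x" if "(replicate k E @ [N]) @ tail t @ [S] = x @ y" for x y
      by (rule mid[OF that E_run]) simp_all
    then show ?thesis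
      using nonneg[of "(replicate k E @ [N]) @ tail t @ [S]"] Node.prems 2 by (simp add: k_def)
  next
    case 3
    have V: "0 \<le> lat x" if "[V] = x @ y" for x y
      using that by (auto simp: Cons_eq_append_conv)
    have "0 \<le> lat x" if "[V] @ tail t @ [S] = x @ y" for x y
      by (rule mid[OF that V]) simp_all
    then show ?thesis using nonneg[of "[V] @ tail t @ [S]"] Node.prems 3 by simp
  qed
qed simp

text \<open>
  If one tail were longer, it would have a prefix consisting of the other tail and an \<open>S\<close>,
  of latitude \<open>-1\<close>.
\<close>

lemma tail_S_cancel:
  assumes "tail t @ S # v = tail t' @ S # w"
  shows "tail t = tail t' \<and> v = w"
proof -
  have *: False if "tail t = tail t' @ S # u" for t t' u
    using lat_prefix_tail[of t "tail t' @ [S]" u] that by simp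
  show ?thesis
    using assms *[of t t'] *[of t' t, OF sym]
    by (auto simp: append_eq_append_conv2 Cons_eq_append_conv append_eq_Cons_conv)
qed

lemma replicate_N_cancel:
  "replicate k E @ N # v = replicate l E @ N # w \<Longrightarrow> k = l \<and> v = w"
proof (induction k arbitrary: l)
  case 0 then show ?case by (cases l) auto
next
  case (Suc k) then show ?case by (cases l) auto
qed

lemma E_run_N_simps [simp]:
  "x \<noteq> E \<Longrightarrow> x \<noteq> N \<Longrightarrow> x # v \<noteq> replicate k E @ N # w"
  "x \<noteq> E \<Longrightarrow> x \<noteq> N \<Longrightarrow> replicate k E @ N # w \<noteq> x # v"
  "replicate k E @ N # v = N # w \<longleftrightarrow> k = 0 \<and> v = w"
  by (cases k; auto)+

text \<open>
  The first letter of the tail tells which clause of \<open>tail\<close> applies. The subtails agree by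
  \<open>tail_S_cancel\<close>, so the valence of \<open>t\<close> is known, and the pointing is this
  valence minus the number of leading letters \<open>E\<close>, or this valence plus one after a
  \<open>V\<close>.
\<close>

lemma tail_inj: "valid t \<Longrightarrow> valid t' \<Longrightarrow> tail t = tail t' \<Longrightarrow> t = t'"
proof (induction t arbitrary: t')
  case Leaf
  then show ?case by (cases t') (auto split: if_splits)
next
  case (Node t i s)
  then obtain u j r where t': "t' = Node u j r"
    by (cases t') (auto split: if_splits)
  note eq = Node.prems(3)[unfolded t']
  have ts: "t = u \<and> s = r" if "tail t @ S # tail s = tail u @ S # tail r"
    using tail_S_cancel[OF that] Node t' by auto
  consider "t = Leaf" | "t \<noteq> Leaf" "i \<le> valence t" | "t \<noteq> Leaf" "\<not> i \<le> valence t" by blast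
  then show ?case
  proof cases
    case 1
    then have "u = Leaf" using eq by (auto split: if_splits)
    then show ?thesis using 1 eq Node t' by auto
  next
    case 2
    then have u: "u \<noteq> Leaf" "j \<le> valence u"
      using eq by (auto split: if_splits)
    then have "replicate (valence t - i) E @ N # tail t @ S # tail s =
       replicate (valence u - j) E @ N # tail u @ S # tail r"
      using eq 2 by simp
    from replicate_N_cancel[OF this] have "valence t - i = valence u - j" "t = u \<and> s = r"
      using ts by auto
    then show ?thesis using 2 u t' by auto
  next
    case 3
    then have u: "u \<noteq> Leaf" "\<not> j \<le> valence u"
      using eq by (auto split: if_splits)
    then show ?thesis using ts eq 3 t' Node by auto
  qed
qed

lemma fish_of_inj: "inj_on fish_of {t. valid t}"
proof (rule inj_onI, unfold mem_Collect_eq)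
  fix t t' assume *: "valid t" "valid t'" "fish_of t = fish_of t'"
  have inj: "G = H" if "jawed j G = jawed k H" for j k G H
    using replicate_N_cancel[of j "G @ [S]" k "H @ [S]"] that by (simp add: jawed_def)
  from * show "t = t'"
    using tail_inj[of t t'] inj[of "valence t" "tail t" "valence t'" "tail t'"]
      jawed_neq_empty_fish[symmetric]
    by (simp add: fish_of_eq jawed_neq_empty_fish split: if_splits)
qed

section \<open>Fish without the letter V\<close>

text \<open>
  One rewriting step at an arbitrary place, defined by recursion along the word so that the place can be
  located by inversion.
\<close>

inductive grow :: "letter list \<Rightarrow> letter list \<Rightarrow> bool" where
  W_NWS: "grow (W # w) (N # W # S # w)"
| N_ENW: "grow (N # w) (E # N # W # w)"
| WN_NW: "grow (W # N # w) (N # W # w)"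
| skip: "grow v w \<Longrightarrow> grow (x # v) (x # w)"

inductive_cases grow_Nil: "grow [] w"
inductive_cases grow_E: "grow (E # v) w"
inductive_cases grow_N: "grow (N # v) w"
inductive_cases grow_W: "grow (W # v) w"
inductive_cases grow_S: "grow (S # v) w"

lemma grow_E_run:
  "grow (replicate k E @ v) w \<Longrightarrow> \<exists>v'. grow v v' \<and> w = replicate k E @ v'"
  by (induction k arbitrary: w) (auto elim!: grow_E)

text \<open>
  No rule rewrites a factor that contains \<open>S\<close>, so a step takes place on one side of it.
\<close>

lemma grow_append_S:
  "grow (v @ S # u) w \<Longrightarrow>
    (\<exists>v'. grow v v' \<and> w = v' @ S # u) \<or> (\<exists>u'. grow u u' \<and> w = v @ S # u')"
proof (induction v arbitrary: w)
  case Nil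
  then show ?case by (auto elim: grow_S)
next
  case (Cons x v)
  from Cons.prems have "grow (x # v @ S # u) w" by simp
  then show ?case
  proof cases
    case W_NWS
    then show ?thesis using grow.W_NWS[of v] by auto
  next
    case N_ENW
    then show ?thesis using grow.N_ENW[of v] by auto
  next
    case (WN_NW v1)
    then obtain v2 where "v = N # v2" by (cases v) auto
    then show ?thesis using WN_NW grow.WN_NW[of v2] by auto
  next
    case (skip v1)
    then show ?thesis using Cons.IH[of v1] grow.skip[of v _ x] by auto
  qed
qed

lemma grow_context: "grow v w \<Longrightarrow> grow (x @ v @ y) (x @ w @ y)"
proof -
  assume "grow v w"
  then have "grow (v @ y) (w @ y)" by induction (auto intro: grow.intros)
  then show ?thesis by (induction x) (auto intro: grow.intros)
qed

text \<open>
  Steps inside \<open>tail t\<close> or \<open>tail s\<close> are covered by induction, which leaves the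
  steps that involve a letter written at the root. Rewriting the \<open>W\<close> of an augmented leaf
  to \<open>NWS\<close> replaces the leaf by a single cell. Rewriting the \<open>N\<close> in front of
  \<open>tail t\<close> to \<open>ENW\<close> replaces \<open>t\<close> by \<open>Node Leaf 1 t\<close>.
  In the remaining case \<open>WN\<close>, the tail of \<open>s\<close> starts with \<open>N\<close>, so
  \<open>s\<close> is \<open>Node a j b\<close> with \<open>j\<close> equal to the valence of
  \<open>a\<close>, and the step moves the cell of the root into \<open>a\<close>.
\<close>

lemma grow_tail:
  "valid t \<Longrightarrow> smooth t \<Longrightarrow> grow (tail t) G \<Longrightarrow>
    \<exists>t'. valid t' \<and> smooth t' \<and> valence t' = valence t \<and> tail t' = G"
proof (induction t arbitrary: G)
  case Leaf
  then show ?case by (auto elim: grow_Nil)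
next
  case (Node t i s)
  have v: "valid t" "valid s" "smooth t" "smooth s" "1 \<le> i" "i \<le> valence t + 1"
    using Node.prems by auto
  have in_s: "\<exists>s'. valid s' \<and> smooth s' \<and> valence s' = valence s \<and> tail s' = H" if "grow (tail s) H" for H
    using Node.IH(2) that v by blast
  show ?case
  proof (cases "t = Leaf")
    case True
    then have i: "i = 1" using v by simp
    from Node.prems(3) True have "grow (W # tail s) G" by simp
    then show ?thesis
    proof (cases rule: grow_W[consumes 1])
      case 1
      then show ?thesis using v True i 1
        by (intro exI[of _ "Node (Node Leaf 1 Leaf) 1 s"]) simp
    next
      case (2 w)
      then obtain a j b where s: "s = Node a j b" by (cases s) auto
      have "a \<noteq> Leaf \<and> j = valence a \<and> w = tail a @ S # tail b"
        using 2(1) v(2,4) by (auto simp: s split: if_splits)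
      then show ?thesis using v s True i 2
        by (intro exI[of _ "Node (Node Leaf 1 a) (Suc j) b"]) auto
    next
      case (3 w)
      then obtain s' where "valid s'" "smooth s'" "valence s' = valence s" "tail s' = w"
        using in_s by blast
      then show ?thesis using True i 3
        by (intro exI[of _ "Node Leaf 1 s'"]) simp
    qed
  next
    case False
    then have i: "i \<le> valence t" using Node.prems(2) by simp
    have "grow (replicate (valence t - i) E @ N # tail t @ S # tail s) G"
      using Node.prems(3) False i by simp
    then obtain G' where G': "grow (N # tail t @ S # tail s) G'"
      and G: "G = replicate (valence t - i) E @ G'"
      using grow_E_run by blast
    from G' show ?thesis
    proof (cases rule: grow_N[consumes 1])
      case 1
      have "replicate (Suc (valence t) - i) E = replicate (valence t - i) E @ [E]"
        using i by (simp add: Suc_diff_le replicate_append_same)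
      then show ?thesis using v False i 1 G
        by (intro exI[of _ "Node (Node Leaf 1 t) i s"]) simp
    next
      case (2 w)
      from grow_append_S[OF 2(2)] show ?thesis
      proof (elim disjE exE conjE)
        fix v' assume *: "grow (tail t) v'" "w = v' @ S # tail s"
        obtain t' where t': "valid t'" "smooth t'" "valence t' = valence t" "tail t' = v'"
          using Node.IH(1) v * by blast
        then have "t' \<noteq> Leaf" using False v i by auto
        then show ?thesis using v * t' False i 2 G
          by (intro exI[of _ "Node t' i s"]) simp
      next
        fix u' assume *: "grow (tail s) u'" "w = tail t @ S # u'"
        obtain s' where "valid s'" "smooth s'" "valence s' = valence s" "tail s' = u'"
          using in_s * by blast
        then show ?thesis using v * False i 2 G
          by (intro exI[of _ "Node t i s'"]) simp
      qed
    qed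
  qed
qed

lemma grow_jawed:
  assumes "grow (replicate j E @ N # G) w"
  shows "w = replicate (Suc j) E @ N # W # G \<or> (\<exists>G'. grow G G' \<and> w = replicate j E @ N # G')"
proof -
  obtain v where "grow (N # G) v" "w = replicate j E @ v"
    using grow_E_run[OF assms] by blast
  then show ?thesis by (auto elim!: grow_N simp: replicate_app_Cons_same)
qed

lemma grow_fish:
  assumes t: "valid t" "smooth t" "t \<noteq> Leaf" and grow: "grow (jawed (valence t) (tail t)) w"
  shows "\<exists>t'. valid t' \<and> smooth t' \<and> t' \<noteq> Leaf \<and> w = jawed (valence t') (tail t')"
proof -
  have "w = jawed (Suc (valence t)) (W # tail t) \<or> (\<exists>G. grow (tail t) G \<and> w = jawed (valence t) G)"
    using grow_jawed[OF grow[unfolded jawed_def]] grow_append_S[of "tail t" "[]"]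
    by (auto simp: jawed_def elim: grow_Nil)
  then show ?thesis
  proof (elim disjE exE conjE)
    assume "w = jawed (Suc (valence t)) (W # tail t)"
    then show ?thesis using t by (intro exI[of _ "Node Leaf 1 t"]) simp
  next
    fix G assume *: "grow (tail t) G" "w = jawed (valence t) G"
    obtain t' where "valid t'" "smooth t'" "valence t' = valence t" "tail t' = G"
      using grow_tail[OF t(1,2) *(1)] by blast
    then show ?thesis using * t valence_pos_iff by (intro exI[of _ t']) force
  qed
qed

lemma nonempty_fish_grow:
  "w \<in> nonempty_fish \<Longrightarrow> grow w w' \<Longrightarrow> w' \<in> nonempty_fish"
proof -
  have "grow w w' \<Longrightarrow> x @ w \<in> nonempty_fish \<Longrightarrow> x @ w' \<in> nonempty_fish" for x
  proof (induction arbitrary: x rule: grow.induct)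
    case (W_NWS w)
    then show ?case using nonempty_fish.W_NWS[of x w] by simp
  next
    case (N_ENW w)
    then show ?case using nonempty_fish.N_ENW[of x w] by simp
  next
    case (WN_NW w)
    then show ?case using nonempty_fish.WN_NW[of x w] by simp
  next
    case (skip v w y)
    then show ?case using skip.IH[of "x @ [y]"] by simp
  qed
  from this[of "[]"] show "w \<in> nonempty_fish \<Longrightarrow> grow w w' \<Longrightarrow> w' \<in> nonempty_fish" by simp
qed

lemma nonempty_fish_imp_tree:
  "w \<in> nonempty_fish \<Longrightarrow> \<exists>t. valid t \<and> smooth t \<and> t \<noteq> Leaf \<and> w = jawed (valence t) (tail t)"
proof (induction rule: nonempty_fish.induct)
  case base
  show ?case by (intro exI[of _ "Node Leaf 1 Leaf"]) (simp add: jawed_def)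
next
  case (W_NWS x y)
  have "grow (x @ [W] @ y) (x @ [N, W, S] @ y)"
    using grow_context[OF grow.W_NWS[of "[]"]] by simp
  with W_NWS.IH show ?case using grow_fish by metis
next
  case (N_ENW x y)
  have "grow (x @ [N] @ y) (x @ [E, N, W] @ y)"
    using grow_context[OF grow.N_ENW[of "[]"]] by simp
  with N_ENW.IH show ?case using grow_fish by metis
next
  case (WN_NW x y)
  have "grow (x @ [W, N] @ y) (x @ [N, W] @ y)"
    using grow_context[OF grow.WN_NW[of "[]"]] by simp
  with WN_NW.IH show ?case using grow_fish by metis
qed

abbreviation grows :: "letter list \<Rightarrow> letter list \<Rightarrow> bool" where
  "grows \<equiv> grow\<^sup>*\<^sup>*"

lemma grows_context: "grows v w \<Longrightarrow> grows (x @ v @ y) (x @ w @ y)"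
  by (induction rule: rtranclp_induct) (auto intro: rtranclp.rtrancl_into_rtrancl grow_context)

lemma grows_N_cases:
  assumes "grows [N] w"
  shows "w = [N] \<or> grows [E, N, W] w"
  using assms by (cases rule: converse_rtranclpE) (auto elim!: grow_N grow_Nil)

text \<open>
  Augmentation follows a derivation of the fish: a step inside \<open>G\<close> is repeated verbatim,
  and the step that prolongs the jaw acts on the second of the two distinguished letters
  \<open>N\<close>. The pointing at the new end of the jaw is reached by acting on the first one instead
  and then carrying the new \<open>W\<close> across the second one. The words are taken without the last
  \<open>S\<close> of the fish, so that the derivation starts at \<open>N\<close> and can replace any
  letter \<open>N\<close> of another fish.
\<close>

lemma grows_augment:
  assumes "grows [E, N, W] w"
  shows "\<exists>j G. w = replicate j E @ N # G \<and> 1 \<le> j \<and>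
    (\<forall>i. 1 \<le> i \<and> i \<le> j \<longrightarrow> grows [N] (replicate i E @ N # replicate (j - i) E @ N # G @ [S]))"
  using assms
proof (induction rule: rtranclp_induct)
  case base
  have "grow [N] [E, N, W]" "grow [E, N, W] [E, N, N, W, S]"
    by (auto intro: grow.intros)
  then have "grows [N] [E, N, N, W, S]" by (meson converse_rtranclp_into_rtranclp r_into_rtranclp)
  moreover have "i = 1" if "1 \<le> i \<and> i \<le> 1" for i :: nat using that by simp
  ultimately show ?case by (intro exI[of _ 1] exI[of _ "[W]"]) auto
next
  case (step v w)
  then obtain j G where v: "v = replicate j E @ N # G" and j: "1 \<le> j"
    and aug: "\<And>i. 1 \<le> i \<Longrightarrow> i \<le> j \<Longrightarrow> grows [N] (replicate i E @ N # replicate (j - i) E @ N # G @ [S])"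
    by blast
  from grow_jawed[OF step(2)[unfolded v]] show ?case
  proof (elim disjE exE conjE)
    assume w: "w = replicate (Suc j) E @ N # W # G"
    have "grows [N] (replicate i E @ N # replicate (Suc j - i) E @ N # W # G @ [S])"
      if i: "1 \<le> i" "i \<le> Suc j" for i
    proof (cases "i \<le> j")
      case True
      have "grow (replicate i E @ N # replicate (j - i) E @ N # G @ [S])
         (replicate i E @ N # replicate (j - i) E @ E # N # W # G @ [S])"
        using grow_context[OF grow.N_ENW[of "G @ [S]"],
            of "replicate i E @ N # replicate (j - i) E" "[]"] by simp
      moreover have "replicate (Suc j - i) E = replicate (j - i) E @ [E]"
        using True by (simp add: Suc_diff_le replicate_append_same)
      ultimately show ?thesis
        using aug[OF i(1) True] by (simp add: rtranclp.rtrancl_into_rtrancl)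
    next
      case False
      then have "i = Suc j" using i by simp
      \<comment> \<open>the pointing at the new end of the jaw, reached from the pointing at the old end\<close>
      have "grow (replicate j E @ N # N # G @ [S]) (replicate j E @ E # N # W # N # G @ [S])"
        using grow_context[OF grow.N_ENW[of "N # G @ [S]"], of "replicate j E" "[]"] by simp
      moreover have "grow (replicate j E @ E # N # W # N # G @ [S])
          (replicate j E @ E # N # N # W # G @ [S])"
        using grow_context[OF grow.WN_NW[of "G @ [S]"], of "replicate j E @ [E, N]" "[]"] by simp
      moreover have "replicate i E = replicate j E @ [E]"
        using \<open>i = Suc j\<close> by (simp add: replicate_append_same)
      ultimately show ?thesis
        using aug[OF j order_refl] \<open>i = Suc j\<close> by (simp add: rtranclp.rtrancl_into_rtrancl)
    qed
    then show ?thesis using w by (intro exI[of _ "Suc j"] exI[of _ "W # G"]) simp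
  next
    fix G' assume *: "grow G G'" "w = replicate j E @ N # G'"
    have "grows [N] (replicate i E @ N # replicate (j - i) E @ N # G' @ [S])" if "1 \<le> i" "i \<le> j" for i
      using aug[OF that] grow_context[OF *(1), of "replicate i E @ N # replicate (j - i) E @ [N]" "[S]"]
      by (simp add: rtranclp.rtrancl_into_rtrancl)
    then show ?thesis using * j by blast
  qed
qed


text \<open>
  Concatenation of fish is substitution: the first \<open>N\<close> of the second word gives rise to the
  augmented first one.
\<close>

lemma grows_tail:
  "valid t \<Longrightarrow> smooth t \<Longrightarrow> grows [N] (replicate (valence t) E @ N # tail t)"
proof (induction t)
  case (Node t i s)
  have v: "valid t" "valid s" "smooth t" "smooth s" "1 \<le> i" "i \<le> valence t + 1"
    using Node.prems by auto
  let ?h = "replicate i E @ N # (if t = Leaf then [W]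
      else replicate (valence t - i) E @ N # tail t @ [S])"
  have "grows [N] ?h"
  proof (cases "t = Leaf")
    case True
    then show ?thesis using v by (auto intro!: r_into_rtranclp grow.intros)
  next
    case False
    have *: "grows [N] (replicate (valence t) E @ N # tail t)"
      using Node.IH v by blast
    have "replicate (valence t) E @ N # tail t \<noteq> [N]"
      using valence_pos_iff[OF v(1)] False by (cases "valence t") auto
    then have "grows [E, N, W] (replicate (valence t) E @ N # tail t)"
      using * grows_N_cases by blast
    from grows_augment[OF this] obtain j G where
      eq: "replicate (valence t) E @ N # tail t = replicate j E @ N # G" and
      "\<forall>i. 1 \<le> i \<and> i \<le> j \<longrightarrow> grows [N] (replicate i E @ N # replicate (j - i) E @ N # G @ [S])"
      by blast
    with replicate_N_cancel[OF eq] show ?thesis using False v Node.prems(2) by simp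
  qed
  then have "grows (replicate (valence s) E @ [N] @ tail s) (replicate (valence s) E @ ?h @ tail s)"
    by (rule grows_context)
  moreover have "grows [N] (replicate (valence s) E @ [N] @ tail s)" using Node.IH v by simp
  moreover have "replicate (valence s) E @ ?h @ tail s
      = replicate (valence (Node t i s)) E @ N # tail (Node t i s)"
    using Node.prems by (auto simp: replicate_add add.commute[of i])
  ultimately show ?case by (metis rtranclp_trans)
qed simp

lemma tree_imp_nonempty_fish:
  assumes "valid t" "smooth t" "t \<noteq> Leaf"
  shows "jawed (valence t) (tail t) \<in> nonempty_fish"
proof -
  let ?w = "replicate (valence t) E @ N # tail t"
  have "?w \<noteq> [N]"
    using valence_pos_iff[OF assms(1)] assms(3) by (cases "valence t") auto
  then have "grows [E, N, W] ?w" using grows_tail[OF assms(1,2)] grows_N_cases by blast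
  from grows_context[OF this, of "[]" "[S]"]
  have "grows [E, N, W, S] (jawed (valence t) (tail t))" by (simp add: jawed_def)
  then show ?thesis
    by (induction rule: rtranclp_induct) (auto intro: nonempty_fish.base nonempty_fish_grow)
qed

lemma fish_of_smooth: "fish_of ` {t. valid t \<and> smooth t} = fighting_fish"
proof
  show "fish_of ` {t. valid t \<and> smooth t} \<subseteq> fighting_fish"
    using tree_imp_nonempty_fish by (auto simp: fighting_fish_def fish_of_eq)
  show "fighting_fish \<subseteq> fish_of ` {t. valid t \<and> smooth t}"
  proof
    fix w assume "w \<in> fighting_fish"
    then consider "w = empty_fish" | "w \<in> nonempty_fish" by (auto simp: fighting_fish_def)
    then show "w \<in> fish_of ` {t. valid t \<and> smooth t}"
    proof cases
      case 1
      then show ?thesis by (intro image_eqI[of _ _ Leaf]) auto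
    next
      case 2
      then obtain t where "valid t" "smooth t" "t \<noteq> Leaf" "w = jawed (valence t) (tail t)"
        using nonempty_fish_imp_tree by blast
      then show ?thesis by (intro image_eqI[of _ _ t]) (auto simp: fish_of_eq)
    qed
  qed
qed

section \<open>Extended fish\<close>

inductive_cases contract_WN_Nil: "contract_WN [] w"
inductive_cases contract_WN_E: "contract_WN (E # v) w"
inductive_cases contract_WN_N: "contract_WN (N # v) w"
inductive_cases contract_WN_W: "contract_WN (W # v) w"
inductive_cases contract_WN_S: "contract_WN (S # v) w"

lemma contract_WN_append:
  "contract_WN v v' \<Longrightarrow> contract_WN w w' \<Longrightarrow> contract_WN (v @ w) (v' @ w')"
  by (induction rule: contract_WN.induct) (auto intro: contract_WN.intros)

lemma contract_WN_refl: "contract_WN w w"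
  by (induction w) (auto intro: contract_WN.intros)

lemma contract_WN_E_run:
  "contract_WN (replicate k E @ v) w \<longleftrightarrow> (\<exists>v'. contract_WN v v' \<and> w = replicate k E @ v')"
  by (induction k arbitrary: w) (auto elim!: contract_WN_E intro: contract_WN.keep)

lemma contract_WN_N_iff: "contract_WN (N # v) w \<longleftrightarrow> (\<exists>v'. contract_WN v v' \<and> w = N # v')"
  by (auto elim: contract_WN_N intro: contract_WN.keep)

lemma contract_WN_append_S:
  "contract_WN (v @ S # u) w \<longleftrightarrow> (\<exists>v' u'. contract_WN v v' \<and> contract_WN u u' \<and> w = v' @ S # u')"
proof
  show "contract_WN (v @ S # u) w \<Longrightarrow> \<exists>v' u'. contract_WN v v' \<and> contract_WN u u' \<and> w = v' @ S # u'"
  proof (induction v arbitrary: w rule: length_induct)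
    case (1 v)
    show ?case
    proof (cases v)
      case Nil
      then show ?thesis using 1 by (auto elim!: contract_WN_S intro!: contract_WN.nil)
    next
      case (Cons x v1)
      with 1(2) have "contract_WN (x # v1 @ S # u) w" by simp
      then show ?thesis
      proof cases
        case (keep w')
        then obtain v' u' where "contract_WN v1 v'" "contract_WN u u'" "w' = v' @ S # u'"
          using 1(1) Cons by (metis length_Cons lessI)
        then show ?thesis using Cons keep
          by (intro exI[of _ "x # v'"] exI[of _ u']) (auto intro: contract_WN.keep)
      next
        case (replace y w')
        then obtain v2 where v2: "v1 = N # v2" "y = v2 @ S # u" by (cases v1) auto
        then obtain v' u' where "contract_WN v2 v'" "contract_WN u u'" "w' = v' @ S # u'"
          using 1(1) Cons replace by (metis length_Cons less_Suc_eq)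
        then show ?thesis using Cons replace v2
          by (intro exI[of _ "V # v'"] exI[of _ u']) (auto intro: contract_WN.replace)
      qed
    qed
  qed
qed (auto intro: contract_WN_append contract_WN.keep)

lemma contract_jawed:
  "contract_WN (jawed j G) w \<longleftrightarrow> (\<exists>H. contract_WN G H \<and> w = jawed j H)"
proof -
  have "contract_WN [] u \<longleftrightarrow> u = []" for u
    by (auto elim: contract_WN_Nil intro: contract_WN.nil)
  then show ?thesis
    unfolding jawed_def contract_WN_E_run contract_WN_N_iff contract_WN_append_S by auto
qed

text \<open>
  A contraction that uses the \<open>W\<close> of an augmented leaf also uses the \<open>N\<close> at
  which the tail of \<open>s\<close> starts. Applying the induction hypothesis with this
  \<open>N\<close> kept shows that the contracted tail of \<open>s\<close> is that of some \<open>Node a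
  j b\<close> with \<open>j\<close> the valence of \<open>a\<close>; contracting \<open>WN\<close> into
  \<open>V\<close> then amounts to the last pointing of \<open>a\<close>.
\<close>

lemma contract_tail:
  "valid t \<Longrightarrow> smooth t \<Longrightarrow> contract_WN (tail t) H \<Longrightarrow>
    \<exists>t'. valid t' \<and> valence t' = valence t \<and> tail t' = H"
proof (induction t arbitrary: H)
  case Leaf
  then have "H = []" by (auto elim: contract_WN_Nil)
  then show ?case by (intro exI[of _ Leaf]) simp
next
  case (Node t i s)
  have v: "valid t" "valid s" "smooth t" "smooth s" "1 \<le> i" "i \<le> valence t + 1"
    using Node.prems by auto
  show ?case
  proof (cases "t = Leaf")
    case True
    then have i: "i = 1" using v by simp
    from Node.prems(3) True have "contract_WN (W # tail s) H" by simp
    then show ?thesis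
    proof (cases rule: contract_WN_W[consumes 1])
      case (1 w)
      then obtain s' where "valid s'" "valence s' = valence s" "tail s' = w"
        using Node.IH(2) v by blast
      then show ?thesis using True i 1
        by (intro exI[of _ "Node Leaf 1 s'"]) simp
    next
      case (2 G w)
      \<comment> \<open>keep the \<open>N\<close> at which the tail of \<open>s\<close> starts, in order to use the induction hypothesis\<close>
      then have "contract_WN (tail s) (N # w)" by (auto intro: contract_WN.keep)
      then obtain s' where s': "valid s'" "valence s' = valence s" "tail s' = N # w"
        using Node.IH(2) v by blast
      then obtain a j b where s'_eq: "s' = Node a j b" by (cases s') auto
      have "a \<noteq> Leaf \<and> j = valence a \<and> w = tail a @ S # tail b"
        using s' by (auto simp: s'_eq split: if_splits)
      then show ?thesis using v s' s'_eq True i 2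
        by (intro exI[of _ "Node a (Suc j) b"]) auto
    qed
  next
    case False
    then have i: "i \<le> valence t" using Node.prems(2) by simp
    have "contract_WN (replicate (valence t - i) E @ N # tail t @ S # tail s) H"
      using Node.prems(3) False i by simp
    then obtain G' H' where *: "contract_WN (tail t) G'" "contract_WN (tail s) H'"
      and H: "H = replicate (valence t - i) E @ N # G' @ S # H'"
      unfolding contract_WN_E_run contract_WN_N_iff contract_WN_append_S by blast
    obtain t' s' where "valid t'" "valence t' = valence t" "tail t' = G'"
      "valid s'" "valence s' = valence s" "tail s' = H'"
      using * Node.IH v by meson
    moreover from this have "t' \<noteq> Leaf" using False v i by auto
    ultimately show ?thesis using v False i H
      by (intro exI[of _ "Node t' i s'"]) simp
  qed
qed

text \<open>
  A node with the last pointing, which writes \<open>V\<close>, is undone by writing \<open>WN\<close>: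
  a cell concatenated with the node that has the pointing before the last.
\<close>

lemma tail_contraction:
  "valid t \<Longrightarrow> \<exists>t'. valid t' \<and> smooth t' \<and> valence t' = valence t \<and> contract_WN (tail t') (tail t)"
proof (induction t)
  case Leaf
  show ?case by (intro exI[of _ Leaf]) (auto intro: contract_WN.nil)
next
  case (Node t i s)
  have v: "valid t" "valid s" "1 \<le> i" "i \<le> valence t + 1"
    using Node.prems by auto
  obtain t' s' where t': "valid t'" "smooth t'" "valence t' = valence t" "contract_WN (tail t') (tail t)"
    and s': "valid s'" "smooth s'" "valence s' = valence s" "contract_WN (tail s') (tail s)"
    using Node.IH v by blast
  have Leaf: "t' = Leaf \<longleftrightarrow> t = Leaf" using t' v valence_pos_iff by metis
  have ts: "contract_WN (tail t' @ S # tail s') (tail t @ S # tail s)"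
    using t' s' contract_WN_append_S by blast
  consider "t = Leaf" | "t \<noteq> Leaf" "i \<le> valence t" | "t \<noteq> Leaf" "\<not> i \<le> valence t" by blast
  then show ?case
  proof cases
    case 1
    then show ?thesis using v s'
      by (intro exI[of _ "Node Leaf 1 s'"]) (auto intro: contract_WN.keep)
  next
    case 2
    then show ?thesis using v s' t' Leaf ts
      by (intro exI[of _ "Node t' i s'"])
        (auto intro!: contract_WN_append contract_WN_refl contract_WN.keep)
  next
    case 3
    then have "i = Suc (valence t)" using v by simp
    then show ?thesis using 3 v s' t' Leaf ts valence_pos_iff[of t]
      by (intro exI[of _ "Node Leaf 1 (Node t' (valence t) s')"])
        (auto intro: contract_WN.replace)
  qed
qed

lemma fish_of_valid: "fish_of ` {t. valid t} = extended_fish"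
proof
  show "fish_of ` {t. valid t} \<subseteq> extended_fish"
  proof
    fix w assume "w \<in> fish_of ` {t. valid t}"
    then obtain t where t: "valid t" "w = fish_of t" by blast
    obtain t' where t': "valid t'" "smooth t'" "valence t' = valence t"
      "contract_WN (tail t') (tail t)"
      using tail_contraction[OF t(1)] by blast
    show "w \<in> extended_fish"
    proof (cases "t = Leaf")
      case True
      then show ?thesis using t by (simp add: extended_fish_def)
    next
      case False
      then have "t' \<noteq> Leaf" using t t' valence_pos_iff by metis
      then have "jawed (valence t') (tail t') \<in> nonempty_fish"
        using tree_imp_nonempty_fish t' by blast
      moreover have "contract_WN (jawed (valence t') (tail t')) w"
        using t t' False contract_jawed by (auto simp: fish_of_eq)
      ultimately show ?thesis
        by (auto simp: extended_fish_def nonempty_extended_fish_def)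
    qed
  qed
  show "extended_fish \<subseteq> fish_of ` {t. valid t}"
  proof
    fix w assume "w \<in> extended_fish"
    then consider "w = empty_fish" | v where "v \<in> nonempty_fish" "contract_WN v w"
      by (auto simp: extended_fish_def nonempty_extended_fish_def)
    then show "w \<in> fish_of ` {t. valid t}"
    proof cases
      case 1
      then show ?thesis by (intro image_eqI[of _ _ Leaf]) auto
    next
      case 2
      obtain t where t: "valid t" "smooth t" "t \<noteq> Leaf" "v = jawed (valence t) (tail t)"
        using nonempty_fish_imp_tree[OF 2(1)] by blast
      then obtain H where H: "contract_WN (tail t) H" "w = jawed (valence t) H"
        using 2 contract_jawed by blast
      obtain t' where t': "valid t'" "valence t' = valence t" "tail t' = H"
        using contract_tail[OF t(1,2) H(1)] by blast
      then have "t' \<noteq> Leaf" using t valence_pos_iff by metis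
      then show ?thesis using t' H by (intro image_eqI[of _ _ t']) (auto simp: fish_of_eq)
    qed
  qed
qed

section \<open>Dyck paths\<close>

lemma height_simps [simp]:
  "height [] = 0" "height (U # w) = 1 + height w" "height (D # w) = height w - 1"
  "height (v @ w) = height v + height w"
  by (auto simp: height_def)

lemma is_dyck_iff: "is_dyck P \<longleftrightarrow> height P = 0 \<and> (\<forall>u v. P = u @ v \<longrightarrow> 0 \<le> height u)"
proof -
  have "(\<forall>k \<le> length P. 0 \<le> height (take k P)) \<longleftrightarrow> (\<forall>u v. P = u @ v \<longrightarrow> 0 \<le> height u)"
  proof safe
    fix u v assume "\<forall>k\<le>length (u @ v). 0 \<le> height (take k (u @ v))"
    then show "0 \<le> height u" by (drule_tac spec[of _ "length u"]) simp
  next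
    fix k assume "\<forall>u v. P = u @ v \<longrightarrow> 0 \<le> height u"
    then show "0 \<le> height (take k P)" by (metis append_take_drop_id)
  qed
  then show ?thesis by (simp add: is_dyck_def)
qed

lemma is_dyck_Nil [simp]: "is_dyck []"
  by (simp add: is_dyck_iff)

lemma is_dyck_height: "is_dyck P \<Longrightarrow> height P = 0"
  by (simp add: is_dyck_iff)

lemma is_dyck_prefix: "is_dyck P \<Longrightarrow> P = u @ v \<Longrightarrow> 0 \<le> height u"
  by (simp add: is_dyck_iff)

lemma is_dyck_append: "is_dyck P \<Longrightarrow> is_dyck Q \<Longrightarrow> is_dyck (P @ Q)"
  by (auto simp: is_dyck_iff append_eq_append_conv2)

lemma is_dyck_split:
  assumes "is_dyck (P @ Q)" "height P = 0"
  shows "is_dyck P" "is_dyck Q"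
proof -
  show "is_dyck P" using assms by (simp add: is_dyck_iff)
  have "0 \<le> height u" if "Q = u @ v" for u v
    using is_dyck_prefix[OF assms(1), of "P @ u" v] that assms(2) by simp
  then show "is_dyck Q" using assms by (simp add: is_dyck_iff)
qed

text \<open>
  Both endpoints of a cover are obtained by inserting a prime Dyck path into the same Dyck path, so this
  transfers the Dyck property in either direction.
\<close>

lemma is_dyck_insert:
  assumes "is_dyck A"
  shows "is_dyck (x @ A @ y) \<longleftrightarrow> is_dyck (x @ y)"
proof
  assume *: "is_dyck (x @ A @ y)"
  have "0 \<le> height u" if "x @ y = u @ v" for u v
  proof -
    from that consider r where "x = u @ r" | r where "u = x @ r" "y = r @ v"
      by (auto simp: append_eq_append_conv2)
    then show ?thesis
    proof cases
      case (1 r)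
      then show ?thesis using is_dyck_prefix[OF *, of u "r @ A @ y"] by simp
    next
      case (2 r)
      then show ?thesis
        using is_dyck_prefix[OF *, of "x @ A @ r" v] is_dyck_height[OF assms] by simp
    qed
  qed
  then show "is_dyck (x @ y)"
    using is_dyck_height[OF *] is_dyck_height[OF assms] by (simp add: is_dyck_iff)
next
  assume *: "is_dyck (x @ y)"
  have "0 \<le> height u" if "x @ A @ y = u @ v" for u v
  proof -
    from that consider r where "x = u @ r" | r s where "u = x @ r" "A = r @ s"
      | r where "u = x @ A @ r" "y = r @ v"
      by (auto simp: append_eq_append_conv2)
    then show ?thesis
    proof cases
      case (1 r)
      then show ?thesis using is_dyck_prefix[OF *, of u "r @ y"] by simp
    next
      case (2 r s)
      then show ?thesis
        using is_dyck_prefix[OF *, of x y] is_dyck_prefix[OF assms, of r s] by simp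
    next
      case (3 r)
      then show ?thesis
        using is_dyck_prefix[OF *, of "x @ r" v] is_dyck_height[OF assms] by simp
    qed
  qed
  then show "is_dyck (x @ A @ y)"
    using is_dyck_height[OF *] is_dyck_height[OF assms] by (simp add: is_dyck_iff)
qed

lemma is_dyck_prime: "is_dyck A \<Longrightarrow> is_dyck (U # A @ [D])"
  unfolding is_dyck_iff
proof safe
  fix u v assume A: "height A = 0" "\<forall>u v. A = u @ v \<longrightarrow> 0 \<le> height u" "U # A @ [D] = u @ v"
  show "0 \<le> height u"
    using A by (auto simp: Cons_eq_append_conv append_eq_append_conv2)
qed simp

lemma is_dyck_join: "is_dyck A \<Longrightarrow> is_dyck B \<Longrightarrow> is_dyck (U # A @ D # B)"
  using is_dyck_append[OF is_dyck_prime] by simp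

text \<open>
  The cut is at the first visit below the starting height. A path that starts with an up step visits the
  starting height again before, whence the second use of the induction hypothesis.
\<close>

lemma first_descent: "height w < 0 \<Longrightarrow> \<exists>A B. w = A @ D # B \<and> is_dyck A"
proof (induction w rule: length_induct)
  case (1 w)
  show ?case
  proof (cases w)
    case Nil
    then show ?thesis using 1 by simp
  next
    case (Cons x v)
    show ?thesis
    proof (cases x)
      case D
      then show ?thesis using Cons by (intro exI[of _ "[]"] exI[of _ v]) simp
    next
      case U
      then obtain A B where A: "v = A @ D # B" "is_dyck A"
        using 1 Cons by force
      have "height B < 0" using A 1(2) Cons U by (simp add: is_dyck_height)
      moreover have "length B < length w" using Cons A by simp
      ultimately obtain A' B' where "B = A' @ D # B'" "is_dyck A'"
        using 1(1) by blast
      then show ?thesis using A Cons U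
        by (intro exI[of _ "U # A @ D # A'"] exI[of _ B']) (simp add: is_dyck_join)
    qed
  qed
qed

lemma is_dyck_Cons: 
  assumes "is_dyck (x # w)"
  obtains A B where "x = U" "w = A @ D # B" "is_dyck A" "is_dyck B"
proof -
  have "0 \<le> height [x]" using is_dyck_prefix[OF assms, of "[x]" w] by simp
  then have x: "x = U" by (cases x) auto
  then obtain A B where A: "w = A @ D # B" "is_dyck A"
    using first_descent[of w] is_dyck_height[OF assms] by auto
  have "height (U # A @ [D]) = 0" using A by (simp add: is_dyck_height)
  then have "is_dyck B" using is_dyck_split(2)[of "U # A @ [D]" B] assms A x by simp
  then show ?thesis using that x A by blast
qed

lemma is_dyck_induct [consumes 1, case_names Nil join]:
  assumes "is_dyck P" "R []"
    "\<And>A B. is_dyck A \<Longrightarrow> is_dyck B \<Longrightarrow> R A \<Longrightarrow> R B \<Longrightarrow> R (U # A @ D # B)"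
  shows "R P"
  using assms(1)
proof (induction P rule: length_induct)
  case (1 P)
  show ?case
  proof (cases P)
    case Nil
    then show ?thesis using assms by simp
  next
    case (Cons x w)
    then obtain A B where "x = U" "w = A @ D # B" "is_dyck A" "is_dyck B"
      using is_dyck_Cons 1 by blast
    then show ?thesis using assms(3) 1 Cons by simp
  qed
qed

lemma prime_cancel:
  assumes "is_dyck A" "is_dyck A'" "A @ D # B = A' @ D # B'"
  shows "A = A' \<and> B = B'"
proof -
  have *: False if "is_dyck A" "is_dyck A'" "A = A' @ D # u" for A A' u
    using is_dyck_prefix[OF that(1), of "A' @ [D]" u] is_dyck_height[OF that(2)] that by simp
  show ?thesis
    using assms *[of A A'] *[of A' A] by (auto simp: append_eq_append_conv2 Cons_eq_append_conv append_eq_Cons_conv)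
qed


section \<open>Contacts\<close>

definition touchdowns :: "step list \<Rightarrow> nat list" where
  "touchdowns P = filter (\<lambda>k. height (take k P) = 0) [1..<length P + 1]"

lemma contacts_eq: "contacts P = 0 # touchdowns P"
  unfolding contacts_def touchdowns_def by (subst upt_conv_Cons) auto

lemma noninitial_contacts_eq: "noninitial_contacts P = length (touchdowns P)"
proof -
  have "filter (\<lambda>k. 0 < k) (touchdowns P) = touchdowns P"
    unfolding touchdowns_def filter_filter by (intro filter_cong) auto
  then show ?thesis by (simp add: noninitial_contacts_def contacts_eq)
qed

lemma touchdowns_append:
  assumes "height P = 0"
  shows "touchdowns (P @ Q) = touchdowns P @ map (\<lambda>k. k + length P) (touchdowns Q)"
proof -
  have "[1..<length (P @ Q) + 1] = [1..<length P + 1] @ map (\<lambda>k. k + length P) [1..<length Q + 1]"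
    by (rule nth_equalityI) (auto simp: nth_append simp del: upt_Suc)
  moreover have "filter (\<lambda>k. height (take k (P @ Q)) = 0) [1..<length P + 1] = touchdowns P"
    unfolding touchdowns_def by (rule filter_cong) auto
  moreover have "filter (\<lambda>k. height (take k (P @ Q)) = 0) (map (\<lambda>k. k + length P) [1..<length Q + 1])
      = map (\<lambda>k. k + length P) (touchdowns Q)"
    unfolding touchdowns_def filter_map using assms
    by (intro arg_cong[of _ _ "map _"] filter_cong) auto
  ultimately show ?thesis by (simp add: touchdowns_def)
qed

lemma noninitial_contacts_Nil [simp]: "noninitial_contacts [] = 0"
  by (simp add: noninitial_contacts_eq touchdowns_def)

lemma noninitial_contacts_append:
  "is_dyck P \<Longrightarrow> noninitial_contacts (P @ Q) = noninitial_contacts P + noninitial_contacts Q"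
  by (simp add: noninitial_contacts_eq touchdowns_append is_dyck_height)

lemma noninitial_contacts_prime:
  assumes "is_dyck A"
  shows "noninitial_contacts (U # A @ [D]) = 1"
proof -
  have "height (take k (U # A @ [D])) \<noteq> 0" if "k \<in> set [1..<length A + 2]" for k
  proof -
    have "take k (U # A @ [D]) = U # take (k - 1) A"
      using that unfolding set_upt by (cases k) auto
    moreover have "0 \<le> height (take (k - 1) A)"
      using is_dyck_prefix[OF assms, of "take (k - 1) A" "drop (k - 1) A"] by simp
    ultimately show ?thesis by simp
  qed
  then have "filter (\<lambda>k. height (take k (U # A @ [D])) = 0) [1..<length A + 2] = []"
    unfolding filter_empty_conv by blast
  moreover have "[1..<length (U # A @ [D]) + 1] = [1..<length A + 2] @ [length A + 2]"
    by simp
  ultimately show ?thesis using is_dyck_height[OF assms]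
    by (simp only: noninitial_contacts_eq touchdowns_def filter_append) simp
qed

lemma noninitial_contacts_join:
  "is_dyck A \<Longrightarrow> noninitial_contacts (U # A @ D # B) = 1 + noninitial_contacts B"
  using noninitial_contacts_append[OF is_dyck_prime, of A B] noninitial_contacts_prime[of A] by simp

lemma noninitial_contacts_eq_0_iff: "is_dyck P \<Longrightarrow> noninitial_contacts P = 0 \<longleftrightarrow> P = []"
  by (induction rule: is_dyck_induct) (auto simp: noninitial_contacts_join)

text \<open>
  Counted from the right, starting at zero, the contact between \<open>A\<close> and \<open>B\<close>
  comes after all non-initial contacts of \<open>B\<close>. So the pointing with index \<open>i\<close>
  cuts off a right part that has \<open>i - 1\<close> contacts, and this property determines the cut.
\<close>

lemma rev_contacts_nth:
  assumes "is_dyck A"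
  shows "rev (contacts (A @ B)) ! noninitial_contacts B = length A"
proof -
  have "contacts (A @ B) = contacts A @ map (\<lambda>k. k + length A) (touchdowns B)"
    using assms by (simp add: contacts_eq touchdowns_append is_dyck_height)
  moreover have "contacts A = filter (\<lambda>k. height (take k A) = 0) [0..<length A] @ [length A]"
    using assms by (simp add: contacts_def is_dyck_height)
  ultimately show ?thesis
    by (simp add: noninitial_contacts_eq nth_append)
qed

lemma split_parts:
  assumes "is_dyck A"
  shows "left_part (noninitial_contacts B + 1) (A @ B) = A"
    "right_part (noninitial_contacts B + 1) (A @ B) = B"
  by (simp_all add: left_part_def right_part_def rev_contacts_nth[OF assms])

lemma ex_split:
  assumes "is_dyck P" "n \<le> noninitial_contacts P"
  obtains A B where "P = A @ B" "is_dyck A" "is_dyck B" "noninitial_contacts B = n"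
  using assms
proof (induction arbitrary: thesis rule: is_dyck_induct)
  case Nil
  then show ?case by simp
next
  case (join A B)
  show ?case
  proof (cases "n \<le> noninitial_contacts B")
    case True
    from join.IH(2)[OF _ True] obtain A' B' where
      "B = A' @ B'" "is_dyck A'" "is_dyck B'" "noninitial_contacts B' = n" by blast
    then show ?thesis using join by (intro join.prems(1)[of "U # A @ D # A'" B']) (auto intro: is_dyck_join)
  next
    case False
    then show ?thesis using join
      by (intro join.prems(1)[of "[]" "U # A @ D # B"]) (auto intro: is_dyck_join simp: noninitial_contacts_join)
  qed
qed

section \<open>Covers below a decomposed path\<close>

lemma tamari_cover_cases:
  assumes "tamari_cover P Q"
  obtains v A w where "P = v @ D # U # A @ D # w" "Q = v @ U # A @ D # D # w"
    "is_dyck A" "is_dyck P" "is_dyck Q" "1 \<le> height v"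
  using assms
proof cases
  case (1 v B w)
  obtain x B' where "B = x # B'" using 1 by (cases B) auto
  then obtain A C where A: "x = U" "B' = A @ D # C" "is_dyck A" "is_dyck C"
    using 1 is_dyck_Cons by metis
  then have "C = []"
    using 1 \<open>B = x # B'\<close> noninitial_contacts_join[of A C] noninitial_contacts_eq_0_iff by simp
  then have B: "B = U # A @ [D]" using A \<open>B = x # B'\<close> by simp
  have P: "is_dyck P" using 1 by simp
  have v: "1 \<le> height v" using is_dyck_prefix[OF P, of "v @ [D]"] 1 by simp
  have UAD: "is_dyck (U # A @ [D])" using A(3) by (rule is_dyck_prime)
  have "is_dyck (v @ D # w)"
    using P 1 B is_dyck_insert[OF UAD, of "v @ [D]" w] by simp
  then have "is_dyck Q"
    using 1 B is_dyck_insert[OF UAD, of v "D # w"] by simp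
  then show ?thesis using that 1 B P A v by simp
qed


lemma relpowp_cover_sizes:
  "(tamari_cover ^^ k) P Q \<Longrightarrow>
    (is_dyck P \<longleftrightarrow> is_dyck Q) \<and> length P = length Q \<and> path_size P = path_size Q"
proof (induction k arbitrary: P)
  case (Suc k)
  then obtain R where R: "tamari_cover P R" "(tamari_cover ^^ k) R Q"
    by (meson relpowp_Suc_D2)
  from R(1) have "is_dyck P \<and> is_dyck R \<and> length P = length R \<and> path_size P = path_size R"
    by (cases rule: tamari_cover_cases) (auto simp: path_size_def)
  then show ?case using Suc.IH[OF R(2)] by simp
qed auto

lemma tamari_cover_context:
  assumes "tamari_cover P Q" "is_dyck (x @ P @ y)"
  shows "tamari_cover (x @ P @ y) (x @ Q @ y)"
  using assms
proof cases
  case (1 v P1 w)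
  then show ?thesis using tamari_cover.intros[of "x @ v" P1 "w @ y"] assms(2) by simp
qed

lemma relpowp_cover_context:
  "(tamari_cover ^^ k) P Q \<Longrightarrow> is_dyck (x @ P @ y) \<Longrightarrow> (tamari_cover ^^ k) (x @ P @ y) (x @ Q @ y)"
proof (induction k arbitrary: P)
  case (Suc k)
  then obtain R where R: "tamari_cover P R" "(tamari_cover ^^ k) R Q"
    by (meson relpowp_Suc_D2)
  have c: "tamari_cover (x @ P @ y) (x @ R @ y)"
    using tamari_cover_context[OF R(1) Suc.prems(2)] .
  then have "is_dyck (x @ R @ y)" by (cases rule: tamari_cover_cases)
  then show ?case using Suc.IH[OF R(2)] c by (meson relpowp_Suc_I2)
qed auto

text \<open>
  The factor moved by a cover cannot straddle the cut: the path before it has height at least one, and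
  stays there within the prime factor, whereas the cut is at height zero.
\<close>

lemma tamari_cover_into_append:
  assumes "tamari_cover P (Q1 @ Q2)" "is_dyck Q1" "is_dyck Q2"
  shows "(\<exists>P1. P = P1 @ Q2 \<and> tamari_cover P1 Q1) \<or> (\<exists>P2. P = Q1 @ P2 \<and> tamari_cover P2 Q2)"
  using assms(1)
proof (cases rule: tamari_cover_cases)
  case (1 v A w)
  have prime: "is_dyck (U # A @ [D])" using is_dyck_prime[OF 1(3)] .
  have cover: "tamari_cover (x @ D # U # A @ D # y) (x @ U # A @ D # D # y)"
    if "is_dyck (x @ D # U # A @ D # y)" for x y
    using tamari_cover.intros[of x "U # A @ [D]" y] that prime noninitial_contacts_prime[OF 1(3)] by simp
  consider (left) u where "v @ U # A @ [D, D] @ u = Q1" "w = u @ Q2"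
    | (right) u where "v = Q1 @ u" "Q2 = u @ U # A @ [D, D] @ w"
    | (cut) u r where "Q1 = v @ u" "U # A @ [D] = u @ r" "u \<noteq> []"
  proof -
    have "(v @ U # A @ [D]) @ [D] @ w = Q1 @ Q2" using 1(2) by simp
    then consider u where "v @ U # A @ [D] @ u = Q1" "[D] @ w = u @ Q2"
      | u where "v @ U # A @ [D] = Q1 @ u" "u @ [D] @ w = Q2" "u \<noteq> []"
      unfolding append_eq_append_conv2[of "v @ U # A @ [D]" "[D] @ w"] by force
    then show thesis
    proof cases
      case (1 u)
      then show thesis
        by (cases u) (auto intro: left cut[of "U # A @ [D]" "[]"])
    next
      case (2 u)
      from 2(1) consider u' where "v = Q1 @ u'" "u = u' @ U # A @ [D]"
        | u' where "Q1 = v @ u'" "U # A @ [D] = u' @ u" "u' \<noteq> []"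
        unfolding append_eq_append_conv2[of v "U # A @ [D]"] by force
      then show thesis using right cut 2 by cases auto
    qed
  qed
  then show ?thesis
  proof cases
    case (left u)
    have "is_dyck ((v @ D # U # A @ D # u) @ Q2)" using 1 left by simp
    moreover have "height (v @ D # U # A @ D # u) = 0" using is_dyck_height[OF assms(2)] left by auto
    ultimately have "is_dyck (v @ D # U # A @ D # u)" using is_dyck_split by blast
    from cover[OF this] show ?thesis using left 1 by auto
  next
    case (right u)
    have "is_dyck (Q1 @ u @ D # U # A @ D # w)" using 1 right by simp
    then have "is_dyck (u @ D # U # A @ D # w)" using is_dyck_split assms(2) is_dyck_height by blast
    from cover[OF this] show ?thesis using right 1 by auto
  next
    case (cut u r)
    then show ?thesis
      using is_dyck_prefix[OF prime, of u r] 1(6) is_dyck_height[OF assms(2)] by simp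
  qed
qed

lemma relpowp_cover_into_append:
  "(tamari_cover ^^ k) P (Q1 @ Q2) \<Longrightarrow> is_dyck Q1 \<Longrightarrow> is_dyck Q2 \<Longrightarrow>
    \<exists>P1 P2 k1 k2. P = P1 @ P2 \<and> k = k1 + k2 \<and>
      (tamari_cover ^^ k1) P1 Q1 \<and> (tamari_cover ^^ k2) P2 Q2"
proof (induction k arbitrary: P)
  case 0
  then show ?case by (intro exI[of _ Q1] exI[of _ Q2] exI[of _ 0]) simp
next
  case (Suc k)
  then obtain R where R: "tamari_cover P R" "(tamari_cover ^^ k) R (Q1 @ Q2)"
    by (meson relpowp_Suc_D2)
  from Suc.IH[OF R(2) Suc.prems(2,3)] obtain P1 P2 k1 k2 where
    *: "R = P1 @ P2" "k = k1 + k2" "(tamari_cover ^^ k1) P1 Q1" "(tamari_cover ^^ k2) P2 Q2"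
    by blast
  have "is_dyck P1" "is_dyck P2" using * relpowp_cover_sizes Suc.prems by blast+
  from tamari_cover_into_append[OF R(1)[unfolded *(1)] this] show ?case
  proof (elim disjE exE conjE)
    fix P' assume P': "P = P' @ P2" "tamari_cover P' P1"
    then have "(tamari_cover ^^ Suc k1) P' Q1" using * by (meson relpowp_Suc_I2)
    then show ?thesis using P' * by (metis add_Suc)
  next
    fix P' assume P': "P = P1 @ P'" "tamari_cover P' P2"
    then have "(tamari_cover ^^ Suc k2) P' Q2" using * by (meson relpowp_Suc_I2)
    then show ?thesis using P' * by (metis add_Suc_right)
  qed
qed

text \<open>
  A cover does not lower any point of the path, so it creates no contact.
\<close>

lemma height_take_shift: "height (take k (D # A @ w)) \<le> height (take k (A @ D # w))"
proof (induction A arbitrary: k)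
  case (Cons x A)
  show ?case
  proof (cases k)
    case (Suc l)
    show ?thesis
    proof (cases l)
      case (Suc m)
      then show ?thesis using Cons[of l] \<open>k = Suc l\<close> by (cases x) auto
    qed (cases x; simp add: Suc)
  qed simp
qed simp

lemma noninitial_contacts_cover:
  assumes "tamari_cover P Q"
  shows "noninitial_contacts Q \<le> noninitial_contacts P"
  using assms
proof (cases rule: tamari_cover_cases)
  case (1 v A w)
  have le: "height (take k P) \<le> height (take k Q)" for k
    using height_take_shift[of "k - length v" "U # A @ [D]" w] 1 by simp
  have "height (take k P) = 0" if "height (take k Q) = 0" for k
    using le[of k] that is_dyck_prefix[OF 1(4), of "take k P" "drop k P"] by simp
  moreover have "length P = length Q" using 1 by simp
  ultimately have "set (touchdowns Q) \<subseteq> set (touchdowns P)"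
    by (auto simp: touchdowns_def)
  moreover have "distinct (touchdowns P)" "distinct (touchdowns Q)"
    by (simp_all add: touchdowns_def)
  ultimately show ?thesis
    unfolding noninitial_contacts_eq by (metis card_mono distinct_card finite_set)
qed

text \<open>
  The alternatives are whether the down step moved by the cover stays inside the path or becomes its
  last step.
\<close>

lemma tamari_cover_into_prime:
  assumes "tamari_cover P (U # A @ [D])" "is_dyck A"
  shows "(\<exists>A'. P = U # A' @ [D] \<and> tamari_cover A' A) \<or>
    (\<exists>A' B'. P = U # A' @ D # B' \<and> A' @ B' = A \<and> is_dyck A' \<and> is_dyck B' \<and> noninitial_contacts B' = 1)"
  using assms(1)
proof (cases rule: tamari_cover_cases)
  case (1 v A0 w)
  let ?X = "U # A0 @ [D]"
  have prime: "is_dyck ?X" using is_dyck_prime[OF 1(3)] .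
  obtain v' where v: "v = U # v'" using 1 by (cases v) auto
  then have A: "A @ [D] = v' @ ?X @ D # w" using 1 by simp
  show ?thesis
  proof (cases w rule: rev_cases)
    case Nil
    then have A: "A = v' @ ?X" using A by simp
    moreover have "height v' = 0" using A is_dyck_height[OF assms(2)] is_dyck_height[OF prime] by simp
    ultimately have "is_dyck v'" using assms(2) is_dyck_split by blast
    then show ?thesis using A prime v Nil 1 noninitial_contacts_prime[OF 1(3)] by auto
  next
    case (snoc w' x)
    then have A: "A = v' @ ?X @ D # w'" and x: "x = D" using A by simp_all
    then have dyck: "is_dyck (v' @ D # ?X @ w')"
      using assms(2) is_dyck_insert[OF prime, of v' "D # w'"] is_dyck_insert[OF prime, of "v' @ [D]" w']
      by simp
    have "tamari_cover (v' @ D # ?X @ w') A"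
      using tamari_cover.intros[of v' ?X w'] dyck prime noninitial_contacts_prime[OF 1(3)] A by simp
    then show ?thesis using v snoc x 1 by auto
  qed
qed

text \<open>
  This makes the contacts of the part behind the distinguished \<open>d\<close> a measure of the
  crossings that \<open>d\<close> can still make along a chain.
\<close>

lemma tamari_cover_into_join:
  assumes "tamari_cover P (U # A @ D # B)" "is_dyck A" "is_dyck B"
  obtains A' B' where "P = U # A' @ D # B'" "is_dyck A'" "is_dyck B'"
    "(tamari_cover (A' @ B') (A @ B) \<and> noninitial_contacts B \<le> noninitial_contacts B') \<or>
     (A' @ B' = A @ B \<and> noninitial_contacts B' = Suc (noninitial_contacts B))"
proof -
  have dyck: "is_dyck R \<and> is_dyck R'" if "tamari_cover R R'" for R R'
    using that by (cases rule: tamari_cover_cases) auto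
  have "tamari_cover P ((U # A @ [D]) @ B)" using assms by simp
  from tamari_cover_into_append[OF this is_dyck_prime[OF assms(2)] assms(3)]
  consider P1 where "P = P1 @ B" "tamari_cover P1 (U # A @ [D])"
    | P2 where "P = (U # A @ [D]) @ P2" "tamari_cover P2 B" by blast
  then show thesis
  proof cases
    case (1 P1)
    from tamari_cover_into_prime[OF 1(2) assms(2)] show thesis
    proof (elim disjE exE conjE)
      fix A' assume A': "P1 = U # A' @ [D]" "tamari_cover A' A"
      have "tamari_cover (A' @ B) (A @ B)"
        using tamari_cover_context[OF A'(2), of "[]" B] dyck[OF A'(2)] assms(3) is_dyck_append by simp
      then show thesis using that[of A' B] 1 A' dyck[OF A'(2)] assms(3) by simp
    next
      fix A' B' assume *: "P1 = U # A' @ D # B'" "A' @ B' = A" "is_dyck A'" "is_dyck B'"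
        "noninitial_contacts B' = 1"
      then show thesis
        using that[of A' "B' @ B"] 1 assms is_dyck_append noninitial_contacts_append by auto
    qed
  next
    case (2 P2)
    have "tamari_cover (A @ P2) (A @ B)"
      using tamari_cover_context[OF 2(2), of A "[]"] dyck[OF 2(2)] assms(2) is_dyck_append by simp
    then show thesis
      using that[of A P2] 2 assms dyck[OF 2(2)] noninitial_contacts_cover[OF 2(2)] by simp
  qed
qed

text \<open>
  The length of the chain splits into covers inside \<open>A B\<close> and crossings of the
  distinguished \<open>d\<close>. Each crossing uses up a contact of \<open>B\<close>, and no other
  cover gives one back.
\<close>

lemma relpowp_cover_into_prime:
  "(tamari_cover ^^ k) P (U # Q @ [D]) \<Longrightarrow> is_dyck Q \<Longrightarrow>
    \<exists>A B l. P = U # A @ D # B \<and> is_dyck A \<and> is_dyck B \<and>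
      (tamari_cover ^^ l) (A @ B) Q \<and> k \<le> l + noninitial_contacts B"
proof (induction k arbitrary: P)
  case 0
  then show ?case by (intro exI[of _ Q] exI[of _ "[]"] exI[of _ 0]) simp
next
  case (Suc k)
  then obtain R where R: "tamari_cover P R" "(tamari_cover ^^ k) R (U # Q @ [D])"
    by (meson relpowp_Suc_D2)
  from Suc.IH[OF R(2) Suc.prems(2)] obtain A B l where
    *: "R = U # A @ D # B" "is_dyck A" "is_dyck B"
      "(tamari_cover ^^ l) (A @ B) Q" "k \<le> l + noninitial_contacts B" by blast
  obtain A' B' where P: "P = U # A' @ D # B'" "is_dyck A'" "is_dyck B'" and
    "(tamari_cover (A' @ B') (A @ B) \<and> noninitial_contacts B \<le> noninitial_contacts B') \<or>
     (A' @ B' = A @ B \<and> noninitial_contacts B' = Suc (noninitial_contacts B))"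
    using tamari_cover_into_join[OF R(1)[unfolded *(1)] *(2,3)] by blast
  then consider "tamari_cover (A' @ B') (A @ B)" "noninitial_contacts B \<le> noninitial_contacts B'"
    | "A' @ B' = A @ B" "noninitial_contacts B' = Suc (noninitial_contacts B)" by blast
  then show ?case
  proof cases
    case 1
    then have "(tamari_cover ^^ Suc l) (A' @ B') Q" using * by (meson relpowp_Suc_I2)
    then show ?thesis using P * 1 by (intro exI[of _ A'] exI[of _ B'] exI[of _ "Suc l"]) simp
  next
    case 2
    then show ?thesis using P * by (intro exI[of _ A'] exI[of _ B'] exI[of _ l]) simp
  qed
qed

section \<open>Longest chains\<close>

text \<open>
  The down step in front of \<open>B\<close> crosses the prime factors of \<open>B\<close> one at a
  time.
\<close>

lemma relpowp_cover_shift: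
  "is_dyck B \<Longrightarrow> is_dyck A \<Longrightarrow>
    (tamari_cover ^^ noninitial_contacts B) (U # A @ D # B) (U # A @ B @ [D])"
proof (induction arbitrary: A rule: is_dyck_induct)
  case (join P R)
  let ?X = "U # P @ [D]"
  have X: "is_dyck ?X" using is_dyck_prime[OF join(1)] .
  have "is_dyck (U # A @ D # U # P @ D # R)" using join by (intro is_dyck_join)
  then have "tamari_cover (U # A @ D # U # P @ D # R) (U # (A @ ?X) @ D # R)"
    using tamari_cover.intros[of "U # A" ?X R] X noninitial_contacts_prime[OF join(1)] by simp
  moreover have "(tamari_cover ^^ noninitial_contacts R) (U # (A @ ?X) @ D # R) (U # (A @ ?X) @ R @ [D])"
    using join.IH(2)[of "A @ ?X"] is_dyck_append[OF join.prems X] by blast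
  ultimately have "(tamari_cover ^^ Suc (noninitial_contacts R))
      (U # A @ D # U # P @ D # R) (U # (A @ ?X) @ R @ [D])"
    by (rule relpowp_Suc_I2)
  then show ?case by (simp add: noninitial_contacts_join[OF join(1)])
qed simp

definition longest_chain :: "step list \<Rightarrow> step list \<Rightarrow> nat \<Rightarrow> bool" where
  "longest_chain P Q m \<longleftrightarrow>
    (tamari_cover ^^ m) P Q \<and> (\<forall>k. (tamari_cover ^^ k) P Q \<longrightarrow> k \<le> m)"

lemma tamari_cover_neq: "tamari_cover P Q \<Longrightarrow> P \<noteq> Q"
  by (cases rule: tamari_cover_cases) auto

lemma chain_refine:
  "\<forall>i<k. tamari_le (C i) (C (Suc i)) \<and> C i \<noteq> C (Suc i) \<Longrightarrow>
    \<exists>l\<ge>k. (tamari_cover ^^ l) (C 0) (C k)"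
proof (induction k)
  case (Suc k)
  then obtain l where l: "l \<ge> k" "(tamari_cover ^^ l) (C 0) (C k)" by auto
  have "tamari_cover\<^sup>*\<^sup>* (C k) (C (Suc k))" "C k \<noteq> C (Suc k)"
    using Suc.prems by (auto simp: tamari_le_def)
  then obtain m where m: "(tamari_cover ^^ m) (C k) (C (Suc k))" "m \<noteq> 0"
    using rtranclp_imp_relpowp[of tamari_cover "C k" "C (Suc k)"] by (metis relpowp_0_E)
  have "(tamari_cover ^^ (l + m)) (C 0) (C (Suc k))"
    using l m by (auto simp: relpowp_add)
  then show ?case using l m by (intro exI[of _ "l + m"]) auto
next
  case 0
  then show ?case by (intro exI[of _ 0]) simp
qed

lemma tamari_distance_eq:
  assumes "longest_chain P Q m"
  shows "tamari_distance (P, Q) = m"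
  unfolding tamari_distance_def fst_conv snd_conv
proof (rule Max_eqI)
  let ?K = "{k. \<exists>C. C 0 = P \<and> C k = Q \<and> (\<forall>i<k. tamari_le (C i) (C (Suc i)) \<and> C i \<noteq> C (Suc i))}"
  show le: "k \<le> m" if "k \<in> ?K" for k
  proof -
    obtain C where C: "C 0 = P" "C k = Q"
      "\<forall>i<k. tamari_le (C i) (C (Suc i)) \<and> C i \<noteq> C (Suc i)"
      using \<open>k \<in> ?K\<close> by blast
    obtain l where "k \<le> l" "(tamari_cover ^^ l) P Q"
      using chain_refine[OF C(3)] unfolding C(1,2) by blast
    then show ?thesis using assms le_trans unfolding longest_chain_def by blast
  qed
  then show "finite ?K" by (meson finite_nat_set_iff_bounded_le)
  obtain C where "C 0 = P" "C m = Q" "\<forall>i<m. tamari_cover (C i) (C (Suc i))"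
    using assms unfolding longest_chain_def relpowp_fun_conv by blast
  then show "m \<in> ?K"
    using tamari_cover_neq by (auto simp: tamari_le_def)
qed

text \<open>
  The bound is attained by moving \<open>d\<close> across all of \<open>B\<close> first: the crossings
  of the prime factors are no longer available once these have been merged.
\<close>

lemma longest_chain_oplus:
  assumes dyck: "is_dyck A" "is_dyck B" "is_dyck P" "is_dyck Q1" "is_dyck Q2"
    and chain1: "longest_chain (A @ B) Q1 m"
    and chain2: "longest_chain P Q2 n"
  shows "longest_chain (U # A @ D # B @ P) (U # Q1 @ D # Q2) (m + noninitial_contacts B + n)"
  unfolding longest_chain_def
proof (intro conjI allI impI)
  let ?c = "noninitial_contacts B"
  have chains: "(tamari_cover ^^ m) (A @ B) Q1" "(tamari_cover ^^ n) P Q2"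
    using chain1 chain2 by (auto simp: longest_chain_def)
  have "(tamari_cover ^^ ?c) (U # A @ D # B @ P) (U # A @ B @ D # P)"
    using relpowp_cover_context[OF relpowp_cover_shift[OF dyck(2,1)], of "[]" P]
      is_dyck_append[OF is_dyck_join[OF dyck(1,2)] dyck(3)] by simp
  moreover have "(tamari_cover ^^ m) (U # A @ B @ D # P) (U # Q1 @ D # P)"
    using relpowp_cover_context[OF chains(1), of "[U]" "D # P"]
      is_dyck_join[OF is_dyck_append[OF dyck(1,2)] dyck(3)] by simp
  moreover have "(tamari_cover ^^ n) (U # Q1 @ D # P) (U # Q1 @ D # Q2)"
    using relpowp_cover_context[OF chains(2), of "U # Q1 @ [D]" "[]"]
      is_dyck_join[OF dyck(4,3)] by simp
  ultimately have "(tamari_cover ^^ (?c + m + n)) (U # A @ D # B @ P) (U # Q1 @ D # Q2)"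
    unfolding relpowp_add by blast
  then show "(tamari_cover ^^ (m + ?c + n)) (U # A @ D # B @ P) (U # Q1 @ D # Q2)"
    by (simp add: add.commute)
next
  fix k assume "(tamari_cover ^^ k) (U # A @ D # B @ P) (U # Q1 @ D # Q2)"
  then have "(tamari_cover ^^ k) ((U # A @ D # B) @ P) ((U # Q1 @ [D]) @ Q2)" by simp
  \<comment> \<open>both cuts are determined by lengths and first returns, so they give back \<open>A\<close>, \<open>B\<close> and \<open>P\<close>\<close>
  from relpowp_cover_into_append[OF this is_dyck_prime[OF dyck(4)] dyck(5)]
  obtain P1 P2 k1 k2 where k: "(U # A @ D # B) @ P = P1 @ P2" "k = k1 + k2"
    "(tamari_cover ^^ k1) P1 (U # Q1 @ [D])" "(tamari_cover ^^ k2) P2 Q2" by blast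
  have chain2': "(tamari_cover ^^ n) P Q2" using chain2 by (simp add: longest_chain_def)
  have len: "length P = length P2"
    using relpowp_cover_sizes[OF k(4)] relpowp_cover_sizes[OF chain2'] by simp
  have "U # A @ D # B = P1 \<and> P = P2"
    using k(1) len by (subst (asm) append_eq_append_conv) simp_all
  then have P: "P1 = U # A @ D # B" "P2 = P" by simp_all
  from relpowp_cover_into_prime[OF k(3) dyck(4)] obtain A' B' l where
    "P1 = U # A' @ D # B'" "is_dyck A'" "(tamari_cover ^^ l) (A' @ B') Q1"
    "k1 \<le> l + noninitial_contacts B'" by blast
  moreover from this have "A' = A \<and> B' = B" using P dyck(1) prime_cancel by blast
  ultimately have "k1 \<le> m + noninitial_contacts B"
    unfolding longest_chain_def using chain1[unfolded longest_chain_def] by auto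
  moreover have "k2 \<le> n" using k(4) P chain2 by (simp add: longest_chain_def)
  ultimately show "k \<le> m + noninitial_contacts B + n" using k(2) by simp
qed

section \<open>The interval of a tree\<close>

fun lower :: "dtree \<Rightarrow> step list" where
  "lower Leaf = []"
| "lower (Node t i s) = U # left_part i (lower t) @ D # right_part i (lower t) @ lower s"

fun upper :: "dtree \<Rightarrow> step list" where
  "upper Leaf = []"
| "upper (Node t i s) = U # upper t @ D # upper s"

abbreviation interval_of :: "dtree \<Rightarrow> interval" where
  "interval_of t \<equiv> (lower t, upper t)"

lemma interval_of_Node: "interval_of (Node t i s) = interval_oplus (interval_of t) i (interval_of s)"
  by (simp add: interval_oplus_def interval_augment_def interval_concat_def)

text \<open>
  The facts about the interval of a valid tree that have to be proved by a common induction: the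
  contacts of the lower path are needed to make sense of the pointing at the next node.
\<close>

definition sound :: "dtree \<Rightarrow> bool" where
  "sound t \<longleftrightarrow> is_dyck (lower t) \<and> is_dyck (upper t) \<and>
    path_size (lower t) = nodes t \<and> path_size (upper t) = nodes t \<and>
    noninitial_contacts (lower t) = valence t \<and> longest_chain (lower t) (upper t) (slack t)"

lemma lower_Node:
  assumes "sound t" "1 \<le> i" "i \<le> valence t + 1"
  obtains A B where "lower t = A @ B" "is_dyck A" "is_dyck B" "noninitial_contacts B = i - 1"
    "noninitial_contacts A + (i - 1) = valence t"
    "left_part i (lower t) = A" "right_part i (lower t) = B"
proof -
  obtain A B where AB: "lower t = A @ B" "is_dyck A" "is_dyck B" "noninitial_contacts B = i - 1"
  proof -
    have "is_dyck (lower t)" "i - 1 \<le> noninitial_contacts (lower t)"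
      using assms by (auto simp: sound_def)
    then show thesis using ex_split that by blast
  qed
  moreover have "i = noninitial_contacts B + 1" using AB assms by simp
  ultimately show thesis
    using that[of A B] split_parts[of A B] assms noninitial_contacts_append[of A B]
    by (simp add: sound_def)
qed

lemma valid_imp_sound: "valid t \<Longrightarrow> sound t"
proof (induction t)
  case Leaf
  have "k = 0" if "(tamari_cover ^^ k) [] []" for k
    using that by (cases k) (auto dest!: relpowp_Suc_D2 elim: tamari_cover.cases)
  then show ?case by (simp add: sound_def path_size_def longest_chain_def)
next
  case (Node t i s)
  then have t: "sound t" "sound s" "1 \<le> i" "i \<le> valence t + 1" by auto
  obtain A B where AB: "lower t = A @ B" "is_dyck A" "is_dyck B" "noninitial_contacts B = i - 1"
    and "left_part i (lower t) = A" "right_part i (lower t) = B"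
    using lower_Node[OF t(1,3,4)] by metis
  then have lower: "lower (Node t i s) = U # A @ D # B @ lower s" by simp
  have "longest_chain (lower (Node t i s)) (upper (Node t i s)) (slack t + (i - 1) + slack s)"
    using longest_chain_oplus[of A B "lower s" "upper t" "upper s" "slack t" "slack s"] t AB
    unfolding lower by (simp add: sound_def)
  moreover have "is_dyck (lower (Node t i s))"
    using AB t is_dyck_join is_dyck_append unfolding lower by (simp add: sound_def)
  moreover have "noninitial_contacts (lower (Node t i s)) = i + valence s"
    using AB t noninitial_contacts_join[of A "B @ lower s"] noninitial_contacts_append[of B "lower s"]
    unfolding lower by (simp add: sound_def)
  moreover have "path_size (lower (Node t i s)) = nodes (Node t i s)"
    using AB t unfolding lower by (simp add: sound_def path_size_def)
  moreover have "path_size (upper (Node t i s)) = nodes (Node t i s)"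
    using t by (simp add: sound_def path_size_def)
  moreover have "is_dyck (upper (Node t i s))"
    using t is_dyck_join by (simp add: sound_def)
  ultimately show ?case by (simp add: sound_def del: lower.simps upper.simps)
qed

lemma interval_of_in: "valid t \<Longrightarrow> interval_of t \<in> tamari_intervals_of_size (nodes t)"
  using valid_imp_sound[of t]
  by (auto simp: sound_def tamari_intervals_of_size_def tamari_le_def longest_chain_def
      dest: relpowp_imp_rtranclp)

lemma length_lower: "valid t \<Longrightarrow> length (lower t) = length (upper t)"
  using valid_imp_sound[of t] relpowp_cover_sizes by (auto simp: sound_def longest_chain_def)

lemma interval_of_inj: "inj_on interval_of {t. valid t}"
proof -
  have "valid t \<Longrightarrow> valid t' \<Longrightarrow> lower t = lower t' \<Longrightarrow> upper t = upper t' \<Longrightarrow> t = t'" for t t'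
  proof (induction t arbitrary: t')
    case Leaf
    then show ?case by (cases t') auto
  next
    case (Node t i s)
    then obtain u j r where t': "t' = Node u j r" by (cases t') auto
    have v: "sound t" "sound u" "1 \<le> i" "i \<le> valence t + 1" "1 \<le> j" "j \<le> valence u + 1"
      using Node.prems t' valid_imp_sound by auto
    obtain A B where AB: "lower t = A @ B" "is_dyck A" "noninitial_contacts B = i - 1"
      "left_part i (lower t) = A" "right_part i (lower t) = B"
      using lower_Node[OF v(1,3,4)] by metis
    obtain A' B' where AB': "lower u = A' @ B'" "is_dyck A'" "noninitial_contacts B' = j - 1"
      "left_part j (lower u) = A'" "right_part j (lower u) = B'"
      using lower_Node[OF v(2,5,6)] by metis
    have "upper t @ D # upper s = upper u @ D # upper r" using Node.prems t' by simp
    then have up: "upper t = upper u" "upper s = upper r"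
      using prime_cancel v unfolding sound_def by metis+
    then have "length (lower s) = length (lower r)"
      using length_lower Node.prems t' by simp
    moreover have "(U # A @ D # B) @ lower s = (U # A' @ D # B') @ lower r"
      using Node.prems(3) AB(4,5) AB'(4,5) t' by simp
    ultimately have "U # A @ D # B = U # A' @ D # B' \<and> lower s = lower r"
      using append_eq_append_conv[of "U # A @ D # B" "U # A' @ D # B'" "lower s" "lower r"] by blast
    then have "A = A'" "B = B'" "lower s = lower r" using prime_cancel AB AB' by blast+
    moreover from this have "i = j" using AB AB' v by simp
    ultimately show ?case using Node up AB AB' t' by simp
  qed
  then show ?thesis by (auto simp: inj_on_def)
qed

text \<open>
  Both components of an interval decompose along the first return of the upper path, and the lower path
  of the first component determines the pointing: one more than the number of contacts of the part
  behind the distinguished \<open>d\<close>.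
\<close>

lemma ex_tree:
  "is_dyck Q \<Longrightarrow> (tamari_cover ^^ k) P Q \<Longrightarrow> \<exists>t. valid t \<and> lower t = P \<and> upper t = Q"
proof (induction arbitrary: P k rule: is_dyck_induct)
  case Nil
  then have "length P = 0" using relpowp_cover_sizes by fastforce
  then show ?case by (intro exI[of _ Leaf]) simp
next
  case (join Q1 Q2)
  then have "(tamari_cover ^^ k) P ((U # Q1 @ [D]) @ Q2)" by simp
  from relpowp_cover_into_append[OF this is_dyck_prime[OF join(1)] join(2)]
  obtain P1 P2 k1 k2 where P: "P = P1 @ P2"
    "(tamari_cover ^^ k1) P1 (U # Q1 @ [D])" "(tamari_cover ^^ k2) P2 Q2" by blast
  from relpowp_cover_into_prime[OF P(2) join(1)] obtain A B l where
    AB: "P1 = U # A @ D # B" "is_dyck A" "is_dyck B" "(tamari_cover ^^ l) (A @ B) Q1" by blast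
  obtain t s where t: "valid t" "lower t = A @ B" "upper t = Q1"
    and s: "valid s" "lower s = P2" "upper s = Q2"
    using join.IH AB P by meson
  have "noninitial_contacts B \<le> valence t"
    using valid_imp_sound[OF t(1)] t noninitial_contacts_append[OF AB(2)] by (simp add: sound_def)
  then show ?case
    using t s P AB split_parts[OF AB(2), of B]
    by (intro exI[of _ "Node t (noninitial_contacts B + 1) s"]) simp
qed

lemma interval_of_valid: "interval_of ` {t. valid t} = tamari_intervals"
proof
  show "interval_of ` {t. valid t} \<subseteq> tamari_intervals"
    using interval_of_in by (auto simp: tamari_intervals_def)
  show "tamari_intervals \<subseteq> interval_of ` {t. valid t}"
    using ex_tree
    by (force simp: tamari_intervals_def tamari_intervals_of_size_def tamari_le_def
        dest!: rtranclp_imp_relpowp)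
qed

section \<open>Synchronized intervals\<close>

definition starts_up :: "step list \<Rightarrow> bool" where
  "starts_up w \<longleftrightarrow> (\<exists>v. w = U # v)"

text \<open>
  For each up step, whether the next step is an up step too. Up to the first entry this is the type of a
  Dyck path, and it is compatible with concatenation.
\<close>

fun rises :: "step list \<Rightarrow> bool list" where
  "rises [] = []"
| "rises (U # w) = starts_up w # rises w"
| "rises (D # w) = rises w"

lemma length_rises: "length (rises w) = path_size w"
  by (induction w rule: rises.induct) (auto simp: path_size_def)

lemma starts_up_append_D: "is_dyck A \<Longrightarrow> starts_up (A @ D # w) \<longleftrightarrow> A \<noteq> []"
  by (cases A) (auto simp: starts_up_def elim: is_dyck_Cons)

lemma rises_append_D: "rises (v @ D # w) = rises v @ rises w"
proof (induction v rule: rises.induct)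
  case (2 v)
  then show ?case by (cases v) (auto simp: starts_up_def)
qed auto

lemma rises_append: "is_dyck v \<Longrightarrow> rises (v @ w) = rises v @ rises w"
  by (induction rule: is_dyck_induct) (simp_all add: rises_append_D starts_up_append_D)

lemma rises_join: "is_dyck A \<Longrightarrow> rises (U # A @ D # w) = (A \<noteq> []) # rises A @ rises w"
  by (simp add: rises_append_D starts_up_append_D)

lemma rises_nth: "m < path_size P \<Longrightarrow> rises P ! m = starts_up (after_up (Suc m) P)"
proof (induction P arbitrary: m rule: rises.induct)
  case (2 w)
  then show ?case by (cases m) (auto simp: path_size_def)
qed (auto simp: path_size_def)

lemma after_up_suffix: "m < path_size P \<Longrightarrow> \<exists>x. P = x @ U # after_up (Suc m) P"
proof (induction P arbitrary: m rule: rises.induct)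
  case (2 w)
  then show ?case
    by (cases m) (auto simp: path_size_def, metis append_Cons)
next
  case (3 w)
  then show ?case by (auto simp: path_size_def) (metis append_Cons)
qed (auto simp: path_size_def)

text \<open>
  A path that starts with an up step and ends below its starting height has come back to that height on
  the way, so that it has a non-empty Dyck prefix.
\<close>

lemma max_dyck_prefix_contacts:
  assumes "height w < 0"
  shows "0 < noninitial_contacts (max_dyck_prefix w) \<longleftrightarrow> starts_up w"
proof -
  let ?L = "{l. l \<le> length w \<and> is_dyck (take l w)}"
  have L: "finite ?L" "?L \<noteq> {}" by (auto intro!: exI[of _ 0])
  then have prefix: "is_dyck (max_dyck_prefix w)"
    using Max_in[OF L] by (simp add: max_dyck_prefix_def)
  obtain A B where A: "w = A @ D # B" "is_dyck A" using first_descent[OF assms] by blast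
  then have "length A \<le> Max ?L" using L by (intro Max_ge) auto
  then have "max_dyck_prefix w \<noteq> []" if "A \<noteq> []"
    using A(1) that unfolding max_dyck_prefix_def take_eq_Nil
    by (metis Nil_is_append_conv le_zero_eq length_0_conv)
  moreover have "starts_up w" if "max_dyck_prefix w \<noteq> []"
  proof -
    obtain x u where u: "max_dyck_prefix w = x # u" using \<open>max_dyck_prefix w \<noteq> []\<close> by (cases "max_dyck_prefix w") auto
    then have "x = U" using prefix is_dyck_Cons by metis
    then show ?thesis
      using u append_take_drop_id[of "Max ?L" w] by (auto simp: max_dyck_prefix_def starts_up_def dest: sym)
  qed
  ultimately have "max_dyck_prefix w \<noteq> [] \<longleftrightarrow> starts_up w"
    using starts_up_append_D[OF A(2), of B] A(1) by blast
  then show ?thesis using noninitial_contacts_eq_0_iff[OF prefix] by (metis neq0_conv)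
qed

lemma path_type_eq_rises:
  assumes "is_dyck P"
  shows "path_type P = of_bool (P \<noteq> []) # map of_bool (rises P)"
proof (rule nth_equalityI)
  show "length (path_type P) = length (of_bool (P \<noteq> []) # map of_bool (rises P))"
    by (simp add: path_type_def contact_vector_def length_rises)
  fix k assume "k < length (path_type P)"
  then have k: "k < path_size P + 1" by (simp add: path_type_def contact_vector_def)
  then have nth: "path_type P ! k = of_bool (0 < contact_entry P k)"
    by (simp add: path_type_def contact_vector_def del: upt_Suc)
  show "path_type P ! k = (of_bool (P \<noteq> []) # map of_bool (rises P)) ! k"
  proof (cases k)
    case 0
    then show ?thesis
      using nth noninitial_contacts_eq_0_iff[OF assms] by (simp add: contact_entry_def)
  next
    case (Suc m)
    then have m: "m < path_size P" using k by simp
    obtain x where x: "P = x @ U # after_up (Suc m) P" using after_up_suffix[OF m] by blast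
    have "0 \<le> height x" using is_dyck_prefix[OF assms x] .
    moreover have "height x + (1 + height (after_up (Suc m) P)) = 0"
      using is_dyck_height[OF assms] x by (metis height_simps(2,4))
    ultimately have "height (after_up (Suc m) P) < 0" by simp
    then show ?thesis
      using max_dyck_prefix_contacts rises_nth[OF m] nth Suc m
      by (simp add: contact_entry_def length_rises)
  qed
qed

text \<open>
  The first rise of the lower path \<open>u A d B P\<close> is that \<open>A\<close> is non-empty, and
  \<open>A\<close> is empty if and only if \<open>i\<close> is the last pointing. The other rises are
  unaffected by the place of \<open>d\<close>.
\<close>

lemma rises_eq_iff_smooth:
  "valid t \<Longrightarrow> rises (lower t) = rises (upper t) \<longleftrightarrow> smooth t"
proof (induction t)
  case (Node t i s)
  then have v: "sound t" "sound s" "1 \<le> i" "i \<le> valence t + 1" "valid t" "valid s"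
    using valid_imp_sound by auto
  obtain A B where AB: "lower t = A @ B" "is_dyck A" "is_dyck B"
    "noninitial_contacts A + (i - 1) = valence t"
    and "left_part i (lower t) = A" "right_part i (lower t) = B"
    using lower_Node[OF v(1,3,4)] by metis
  then have lower: "lower (Node t i s) = U # A @ D # B @ lower s" by simp
  have A: "A \<noteq> [] \<longleftrightarrow> i \<le> valence t"
    using noninitial_contacts_eq_0_iff[OF AB(2)] AB(4) v by auto
  have up: "upper t \<noteq> [] \<longleftrightarrow> t \<noteq> Leaf" by (cases t) auto
  have "rises (lower (Node t i s)) = (A \<noteq> []) # rises (lower t) @ rises (lower s)"
    using AB unfolding lower by (simp add: rises_join rises_append del: rises.simps)
  moreover have "rises (upper (Node t i s)) = (upper t \<noteq> []) # rises (upper t) @ rises (upper s)"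
    using v by (simp add: rises_join sound_def del: rises.simps)
  moreover have "length (rises (lower t)) = length (rises (upper t))"
    using v by (simp add: length_rises sound_def)
  ultimately have "rises (lower (Node t i s)) = rises (upper (Node t i s)) \<longleftrightarrow>
      (A \<noteq> []) = (upper t \<noteq> []) \<and> rises (lower t) = rises (upper t) \<and> rises (lower s) = rises (upper s)"
    by (simp del: lower.simps upper.simps)
  then show ?case using A up Node.IH v by (auto simp del: lower.simps upper.simps)
qed simp

lemma synchronized_iff_smooth:
  assumes "valid t"
  shows "interval_of t \<in> synchronized_intervals \<longleftrightarrow> smooth t"
proof -
  have "map of_bool bs = (map of_bool cs :: nat list) \<longleftrightarrow> bs = cs" for bs cs
    by (rule inj_map_eq_map) (auto simp: inj_def)
  moreover have "lower t = [] \<longleftrightarrow> upper t = []" using length_lower[OF assms] by auto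
  ultimately have "path_type (lower t) = path_type (upper t) \<longleftrightarrow> smooth t"
    using valid_imp_sound[OF assms] rises_eq_iff_smooth[OF assms]
    by (simp add: path_type_eq_rises sound_def)
  then show ?thesis
    using assms interval_of_valid by (auto simp: synchronized_intervals_def)
qed

section \<open>The bijection\<close>

theorem theorem2:
  shows "\<exists>\<Phi> :: interval \<Rightarrow> letter list.
    fish_recursion \<Phi> \<and>
    (\<forall>\<Psi>. fish_recursion \<Psi> \<longrightarrow> (\<forall>I \<in> tamari_intervals. \<Psi> I = \<Phi> I)) \<and>
    (\<forall>I i. pointed_interval I i \<longrightarrow> pointed_fish (\<Phi> I) i) \<and>
    bij_betw \<Phi> tamari_intervals extended_fish \<and>
    (\<forall>n. \<forall>I \<in> tamari_intervals_of_size n.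
       fish_size (\<Phi> I) = int n \<and>
       jaw (\<Phi> I) = interval_contacts I \<and>
       area (\<Phi> I) = int (tamari_distance I) + int n) \<and>
    bij_betw \<Phi> synchronized_intervals fighting_fish"
proof -
  define \<Phi> where "\<Phi> I = fish_of (inv_into {t. valid t} interval_of I)" for I
  have \<Phi>: "\<Phi> (interval_of t) = fish_of t" if "valid t" for t
    unfolding \<Phi>_def using inv_into_f_f[OF interval_of_inj] that by simp
  have tree: "\<exists>t. valid t \<and> I = interval_of t" if "I \<in> tamari_intervals" for I
    using that interval_of_valid by blast
  have contacts: "interval_contacts (interval_of t) = valence t" if "valid t" for t
    using valid_imp_sound[OF that] by (simp add: interval_contacts_def sound_def)
  have in_intervals: "interval_of t \<in> tamari_intervals" if "valid t" for t
    using that interval_of_valid by blast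
  have recursion: "fish_recursion \<Phi>"
    unfolding fish_recursion_def
  proof (intro conjI allI impI)
    show "\<Phi> empty_interval = empty_fish" using \<Phi>[of Leaf] by (simp add: empty_interval_def)
    fix I1 i I2 assume I: "pointed_interval I1 i" "I2 \<in> tamari_intervals"
    then obtain t s where t: "valid t" "I1 = interval_of t" "valid s" "I2 = interval_of s"
      using tree[of I1] tree[of I2] unfolding pointed_interval_def by blast
    then have "valid (Node t i s)" using I contacts by (simp add: pointed_interval_def)
    then show "\<Phi> (interval_oplus I1 i I2) = fish_oplus (\<Phi> I1) i (\<Phi> I2)"
      unfolding t(2,4) interval_of_Node[symmetric] \<Phi>[OF t(1)] \<Phi>[OF t(3)]
      using \<Phi>[of "Node t i s"] by (simp only: fish_of.simps)
  qed
  moreover have "\<Psi> I = \<Phi> I" if "fish_recursion \<Psi>" "I \<in> tamari_intervals" for \<Psi> I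
  proof -
    have "\<Psi> (interval_of t) = fish_of t" if "valid t" for t
      using that
    proof (induction t)
      case Leaf
      then show ?case using \<open>fish_recursion \<Psi>\<close> by (simp add: fish_recursion_def empty_interval_def)
    next
      case (Node t i s)
      then have "pointed_interval (interval_of t) i" "interval_of s \<in> tamari_intervals"
        using in_intervals contacts by (auto simp: pointed_interval_def)
      then have "\<Psi> (interval_oplus (interval_of t) i (interval_of s))
          = fish_oplus (\<Psi> (interval_of t)) i (\<Psi> (interval_of s))"
        using \<open>fish_recursion \<Psi>\<close> unfolding fish_recursion_def by blast
      then show ?case
        using Node.IH Node.prems unfolding interval_of_Node fish_of.simps valid.simps by metis
    qed
    then show ?thesis using tree[OF that(2)] \<Phi> by auto
  qed
  moreover have "pointed_fish (\<Phi> I) i" if "pointed_interval I i" for I i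
  proof -
    obtain t where "valid t" "I = interval_of t"
      using tree \<open>pointed_interval I i\<close> unfolding pointed_interval_def by blast
    then show ?thesis
      using that \<Phi>[of t] contacts[of t] fish_of_valid jaw_fish_of[of t]
      by (auto simp: pointed_interval_def pointed_fish_def)
  qed
  moreover have "bij_betw \<Phi> tamari_intervals extended_fish"
    unfolding bij_betw_def
  proof
    show "inj_on \<Phi> tamari_intervals"
    proof (rule inj_onI)
      fix I J assume *: "I \<in> tamari_intervals" "J \<in> tamari_intervals" "\<Phi> I = \<Phi> J"
      obtain t s where ts: "valid t" "I = interval_of t" "valid s" "J = interval_of s"
        using tree[OF *(1)] tree[OF *(2)] by blast
      then have "fish_of t = fish_of s" using *(3) \<Phi>[OF ts(1)] \<Phi>[OF ts(3)] by simp
      then show "I = J" using inj_onD[OF fish_of_inj] ts by blast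
    qed
    show "\<Phi> ` tamari_intervals = extended_fish"
      unfolding fish_of_valid[symmetric] interval_of_valid[symmetric] image_image
      using \<Phi> by (intro image_cong) auto
  qed
  moreover have "fish_size (\<Phi> I) = int n \<and> jaw (\<Phi> I) = interval_contacts I \<and>
      area (\<Phi> I) = int (tamari_distance I) + int n"
    if I: "I \<in> tamari_intervals_of_size n" for n I
  proof -
    obtain t where t: "valid t" "I = interval_of t"
      using tree I unfolding tamari_intervals_def by blast
    then have "n = nodes t"
      using I valid_imp_sound[of t] by (simp add: tamari_intervals_of_size_def sound_def)
    moreover have "tamari_distance I = slack t"
      using t(1) valid_imp_sound[of t] tamari_distance_eq unfolding t(2) sound_def by blast
    ultimately show ?thesis
      using t(2) \<Phi>[OF t(1)] contacts[OF t(1)] fish_size_fish_of[OF t(1)] jaw_fish_of[OF t(1)]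
        area_fish_of[OF t(1)] by simp
  qed
  moreover have "bij_betw \<Phi> synchronized_intervals fighting_fish"
    unfolding bij_betw_def
  proof
    have sync: "synchronized_intervals = interval_of ` {t. valid t \<and> smooth t}"
    proof (intro equalityI subsetI)
      fix I assume I: "I \<in> synchronized_intervals"
      then have "I \<in> tamari_intervals" by (auto simp: synchronized_intervals_def)
      then obtain t where t: "valid t" "I = interval_of t" using tree by blast
      then have "smooth t" using synchronized_iff_smooth[OF t(1)] I by simp
      with t show "I \<in> interval_of ` {t. valid t \<and> smooth t}" by blast
    next
      fix I assume "I \<in> interval_of ` {t. valid t \<and> smooth t}"
      then show "I \<in> synchronized_intervals" using synchronized_iff_smooth by auto
    qed
    show "inj_on \<Phi> synchronized_intervals"
    proof (rule inj_on_subset)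
      show "inj_on \<Phi> tamari_intervals"
        using \<open>bij_betw \<Phi> tamari_intervals extended_fish\<close> by (rule bij_betw_imp_inj_on)
      show "synchronized_intervals \<subseteq> tamari_intervals" by (auto simp: synchronized_intervals_def)
    qed
    show "\<Phi> ` synchronized_intervals = fighting_fish"
      unfolding sync fish_of_smooth[symmetric] image_image using \<Phi> by (intro image_cong) auto
  qed
  ultimately show ?thesis by blast
qed

end
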